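(* Let $Y\ge 0$ be a random variable with mean $\mu$ and variance $\sigma^2\in(0,\infty)$, and let $Y^s$ be defined on the same probability space as $Y$ and have the $Y$-size biased distribution. Suppose $|Y^s-Y|\le B$ for some constant $B\le\sigma^{3/2}/\sqrt{6\mu}$. Let $W=(Y-\mu)/\sigma$, let $\mathcal{H}$ be a class of functions satisfying (i), (ii), (iii) of the context with constant $a$, and let $\delta=\sup_{h\in\mathcal{H}}|E h(W)-Nh|$. Then, with $A=B/\sigma$ and $\Delta=\sqrt{\mathrm{Var}(E(Y^s-Y\mid Y))}$, $$\delta\le\frac{aA}{2}+\frac{\mu}{\sigma}\left((19+56a)A^2+4A^3\right)+\frac{23\mu\Delta}{\sigma^2}.$$ Moreover, when $\mathcal{H}$ is the collection of indicators of all half lines (using $a=\sqrt{2/\pi}$), and when $\mathcal{H}$ is the collection of indicators of all intervals (using $a=2\sqrt{2/\pi}$), we have respectively $$\delta\le 0.4A+\frac{\mu}{\sigma}\left(64A^2+4A^3\right)+\frac{23\Delta\mu}{\sigma^2}\qquad\text{and}\qquad\delta\le 0.8A+\frac{\mu}{\sigma}\left(109A^2+4A^3\right)+\frac{23\Delta\mu}{\sigma^2}.$$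
   Context: Size bias: for a non-negative random variable $Y$ with finite mean $EY=\mu$, a random variable $Y^s$ has the $Y$-size biased distribution if $E[Yf(Y)]=\mu E[f(Y^s)]$ for all functions $f$ for which the expectation of either side exists. $Nh=E h(Z)$ where $Z\sim\mathcal{N}(0,1)$. $\mathcal{H}$ is a class of measurable functions on the real line such that: (i) the functions $h\in\mathcal{H}$ are uniformly bounded in absolute value by $1$; (ii) for any real numbers $c,d$ and any $h\in\mathcal{H}$, the function $x\mapsto h(cx+d)$ is in $\mathcal{H}$; (iii) for any $\epsilon>0$ and $h\in\mathcal{H}$, the functions $h^+_\epsilon(x)=\sup_{|y|\le\epsilon}h(x+y)$ and $h^-_\epsilon(x)=\inf_{|y|\le\epsilon}h(x+y)$ are also in $\mathcal{H}$, and, with $\tilde h_\epsilon=h^+_\epsilon-h^-_\epsilon$, $E\tilde h_\epsilon(Z)\le a\epsilon$ for some constant $a$ depending only on the class $\mathcal{H}$. *)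

theory Defs
  imports "HOL-Probability.Probability"
begin

text \<open>The variable \<open>Ys\<close> may live on a different probability space than \<open>Y\<close>.  If one of the
  two expectations exists (is finite), then so does the other, and the identity holds; without the
  integrability clause the Bochner integral would give the junk value 0 to a divergent side.\<close>

definition has_size_biased_distribution ::
    "'b measure \<Rightarrow> ('b \<Rightarrow> real) \<Rightarrow> 'a measure \<Rightarrow> ('a \<Rightarrow> real) \<Rightarrow> bool" where
  "has_size_biased_distribution N Ys M Y \<longleftrightarrow>
     Ys \<in> borel_measurable N \<and>
     (\<forall>f \<in> borel_measurable borel.
        integrable M (\<lambda>\<omega>. Y \<omega> * f (Y \<omega>)) \<or> integrable N (\<lambda>\<omega>. f (Ys \<omega>)) \<longrightarrow>
        integrable M (\<lambda>\<omega>. Y \<omega> * f (Y \<omega>)) \<and> integrable N (\<lambda>\<omega>. f (Ys \<omega>)) \<and>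
        (\<integral>\<omega>. Y \<omega> * f (Y \<omega>) \<partial>M) = (\<integral>\<omega>. Y \<omega> \<partial>M) * (\<integral>\<omega>. f (Ys \<omega>) \<partial>N))"

definition normal_mean :: "(real \<Rightarrow> real) \<Rightarrow> real" where
  "normal_mean h = (\<integral>x. h x \<partial>std_normal_distribution)"

definition upper_env :: "real \<Rightarrow> (real \<Rightarrow> real) \<Rightarrow> real \<Rightarrow> real" where
  "upper_env \<epsilon> h x = (SUP y \<in> {y. \<bar>y\<bar> \<le> \<epsilon>}. h (x + y))"

definition lower_env :: "real \<Rightarrow> (real \<Rightarrow> real) \<Rightarrow> real \<Rightarrow> real" where
  "lower_env \<epsilon> h x = (INF y \<in> {y. \<bar>y\<bar> \<le> \<epsilon>}. h (x + y))"

definition test_class :: "(real \<Rightarrow> real) set \<Rightarrow> real \<Rightarrow> bool" where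
  "test_class H a \<longleftrightarrow>
     H \<subseteq> borel_measurable borel \<and>
     (\<forall>h\<in>H. \<forall>x. \<bar>h x\<bar> \<le> 1) \<and>
     (\<forall>h\<in>H. \<forall>c d. (\<lambda>x. h (c * x + d)) \<in> H) \<and>
     (\<forall>h\<in>H. \<forall>\<epsilon>>0. upper_env \<epsilon> h \<in> H \<and> lower_env \<epsilon> h \<in> H \<and>
        normal_mean (\<lambda>x. upper_env \<epsilon> h x - lower_env \<epsilon> h x) \<le> a * \<epsilon>)"

text \<open>Taken in the extended reals so that the supremum is meaningful for every \<open>H\<close>; for the
  nonempty, uniformly bounded classes of interest it is the ordinary real supremum.\<close>

definition normal_distance :: "'a measure \<Rightarrow> ('a \<Rightarrow> real) \<Rightarrow> (real \<Rightarrow> real) set \<Rightarrow> ereal" where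
  "normal_distance M W H = (SUP h\<in>H. ereal \<bar>(\<integral>\<omega>. h (W \<omega>) \<partial>M) - normal_mean h\<bar>)"

text \<open>Open and closed half lines, in both directions.\<close>

definition half_lines :: "real set set" where
  "half_lines = range lessThan \<union> range atMost \<union> range greaterThan \<union> range atLeast"

definition half_line_indicators :: "(real \<Rightarrow> real) set" where
  "half_line_indicators = {indicator S | S. S \<in> half_lines}"

text \<open>On the real line \<^const>\<open>is_interval\<close> covers open, closed, half-open, degenerate and
  unbounded intervals.\<close>

definition interval_indicators :: "(real \<Rightarrow> real) set" where
  "interval_indicators = {indicator S | S. is_interval S}"

text \<open>The conditional expectation of \<open>X\<close> given the random variable \<open>Y\<close>, that is, given the
  sigma-algebra on the sample space generated by \<open>Y\<close>.\<close>

definition cond_exp_given :: "'a measure \<Rightarrow> ('a \<Rightarrow> real) \<Rightarrow> ('a \<Rightarrow> real) \<Rightarrow> 'a \<Rightarrow> real" where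
  "cond_exp_given M X Y = real_cond_exp M (vimage_algebra (space M) Y borel) X"

end

theory Submission
  imports Defs
begin

text \<open>
  The proof is Stein's method applied to a smoothed test function.  Write \<open>\<kappa> = \<mu> / \<sigma>\<close>,
  \<open>A = B / \<sigma>\<close>, \<open>Ws = (Ys - \<mu>) / \<sigma>\<close>, and \<open>N g\<close> for the mean of \<open>g\<close> under the standard normal law.

  Let \<open>f\<close> solve Stein's equation \<open>f'(x) - x f(x) = g(x) - N g\<close> for a continuous \<open>g\<close> with
  \<open>\<bar>g\<bar> \<le> 1\<close>; then \<open>\<bar>f\<bar> \<le> 5\<close> and \<open>\<bar>f'\<bar> \<le> 4\<close> (lemma \<open>stein_equation_solution\<close>).  The size bias
  identity reads \<open>E W f(W) = \<kappa> E (f(Ws) - f(W))\<close>, so that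
  \<open> E g(W) - N g = E f'(W) (1 - \<kappa> (Ws - W)) - \<kappa> E (f(Ws) - f(W) - f'(W) (Ws - W)). \<close>
  Conditioning on \<open>Y\<close> bounds the first term by \<open>4 \<mu> \<Delta> / \<sigma>\<^sup>2\<close>
  (lemma \<open>conditional_mean_error_le\<close>).  The second is at most \<open>\<kappa> A\<close> times the variation of \<open>f'\<close>
  over distance \<open>A\<close>, and \<open>f'\<close> varies like \<open>x f(x) + g(x)\<close>.

  For a discontinuous \<open>g\<close> this would leave \<open>\<kappa> A\<close> times the oscillation of \<open>g\<close> on radius \<open>A\<close>,
  which is useless, since \<open>\<kappa> A \<ge> 1\<close>.  Therefore \<open>g\<close> is the average of some \<open>h\<close> in the class over
  windows of radius \<open>t\<close>: its variation over distance \<open>A\<close> is smaller than the oscillation of \<open>h\<close> on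
  radius \<open>t + A\<close> by a factor \<open>A / (2 t)\<close>.  As the envelopes of \<open>h\<close> lie in the class, the mean of
  that oscillation at \<open>W\<close> is at most \<open>a (t + A) + 2 \<delta>\<close>, where \<open>\<delta>\<close> is the supremum of the error
  over the class (lemma \<open>error_moving_average_le\<close>).  In the other direction \<open>h\<close> lies between
  averages of its own lower and upper envelopes, so smoothing costs only \<open>2 a t\<close>
  (lemma \<open>error_le_smoothed\<close>).  Together,
  \<open> \<delta> \<le> 2 a t + 4 \<mu> \<Delta> / \<sigma>\<^sup>2 + 9 \<kappa> A\<^sup>2 + (\<kappa> A\<^sup>2 / (2 t)) (a (t + A) + 2 \<delta>). \<close>
  With \<open>t = 2 \<kappa> A\<^sup>2\<close> the coefficient of \<open>\<delta>\<close> on the right is \<open>1/2\<close>.  Absorbing it gives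
  \<open>\<delta> \<le> a A / 2 + (18 + 9 a) \<kappa> A\<^sup>2 + 8 \<mu> \<Delta> / \<sigma>\<^sup>2\<close>, within the bounds claimed.

  For half lines and intervals it remains to see that the oscillation of an indicator on radius
  \<open>\<epsilon>\<close> is supported on one, respectively two, intervals of length \<open>2 \<epsilon>\<close>, and that
  \<open>sqrt (2 / \<pi>) \<le> 0.8\<close>.
\<close>

section \<open>Stein's equation for the normal distribution\<close>

lemma std_normal_density_has_derivative:
  "(std_normal_density has_real_derivative - x * std_normal_density x) (at x within S)"
  unfolding std_normal_density_def
  by (auto intro!: derivative_eq_intros simp: field_simps)

lemma integrable_std_normal_bounded:
  fixes h :: "real \<Rightarrow> real"
  assumes "h \<in> borel_measurable borel" "\<And>x. \<bar>h x\<bar> \<le> C"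
  shows "integrable std_normal_distribution h"
proof -
  interpret prob_space std_normal_distribution
    by (rule prob_space_normal_density) simp
  show ?thesis
    by (rule integrable_const_bound[of _ C]) (use assms in auto)
qed

lemma abs_normal_mean_le:
  assumes "h \<in> borel_measurable borel" "\<And>x. \<bar>h x\<bar> \<le> C"
  shows "\<bar>normal_mean h\<bar> \<le> C"
proof -
  interpret prob_space std_normal_distribution
    by (rule prob_space_normal_density) simp
  have "0 \<le> C" using assms(2)[of 0] by linarith
  have "\<bar>normal_mean h\<bar> \<le> (\<integral>x. \<bar>h x\<bar> \<partial>std_normal_distribution)"
    unfolding normal_mean_def by (rule integral_abs_bound)
  also have "\<dots> \<le> (\<integral>x. C \<partial>std_normal_distribution)"
    by (intro integral_mono integrable_std_normal_bounded[where C=C])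
      (use assms \<open>0 \<le> C\<close> in auto)
  finally show ?thesis by (simp add: prob_space del: space_density)
qed

lemma normal_mean_mono:
  assumes "h \<in> borel_measurable borel" "\<And>x. \<bar>h x\<bar> \<le> C"
    and "k \<in> borel_measurable borel" "\<And>x. \<bar>k x\<bar> \<le> D"
    and "\<And>x. h x \<le> k x"
  shows "normal_mean h \<le> normal_mean k"
  unfolding normal_mean_def
  by (intro integral_mono integrable_std_normal_bounded[where C=C]
      integrable_std_normal_bounded[where C=D] assms)

text \<open>Mills' inequality: on the half line beyond \<open>w\<close> the density is at most
  \<open>x \<phi>(x) / w\<close>, and \<open>- \<phi>\<close> is an antiderivative of \<open>x \<phi>(x)\<close>.\<close>

lemma std_normal_upper_tail_le:
  assumes "0 \<le> w"
  shows "w * measure std_normal_distribution {w..} \<le> std_normal_density w"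
proof -
  interpret prob_space std_normal_distribution
    by (rule prob_space_normal_density) simp
  have lim: "((\<lambda>x. - std_normal_density x) \<longlongrightarrow> 0) at_top"
  proof -
    have "LIM x at_top. (1 / 2) * x\<^sup>2 :> (at_top :: real filter)"
      by (rule filterlim_tendsto_pos_mult_at_top[OF tendsto_const _
            filterlim_pow_at_top[OF _ filterlim_ident]]) auto
    then have "LIM x at_top. x\<^sup>2 / 2 :> (at_top :: real filter)" by simp
    then have "((\<lambda>x::real. exp (- (x\<^sup>2 / 2))) \<longlongrightarrow> 0) at_top"
      by (intro filterlim_compose[OF exp_at_bot]) (simp add: filterlim_uminus_at_top)
    from tendsto_mult_right_zero[OF this, of "- 1 / sqrt (2 * pi)"]
    show ?thesis by (simp add: std_normal_density_def)
  qed
  have "ennreal w * emeasure std_normal_distribution {w..}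
      = (\<integral>\<^sup>+x. ennreal w * (ennreal (std_normal_density x) * indicator {w..} x) \<partial>lborel)"
    by (subst emeasure_density) (auto simp: nn_integral_cmult)
  also have "\<dots> \<le> (\<integral>\<^sup>+x. ennreal (x * std_normal_density x) * indicator {w..} x \<partial>lborel)"
    using assms by (intro nn_integral_mono)
      (auto simp: indicator_def ennreal_mult'[symmetric] intro!: ennreal_leI mult_right_mono)
  also have "\<dots> = ennreal (0 - - std_normal_density w)"
    using assms
    by (intro nn_integral_FTC_atLeast lim)
      (auto intro!: derivative_eq_intros std_normal_density_has_derivative)
  finally show ?thesis
    using assms by (simp add: emeasure_eq_measure ennreal_mult'[symmetric] measure_nonneg)
qed

lemma std_normal_lower_tail_eq:
  "measure std_normal_distribution {..w} = measure std_normal_distribution {- w..}"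
proof -
  have "emeasure std_normal_distribution {..w}
      = (\<integral>\<^sup>+x. ennreal (std_normal_density x) * indicator {..w} x \<partial>lborel)"
    by (subst emeasure_density) auto
  also have "\<dots> = (\<integral>\<^sup>+x. ennreal (std_normal_density (- x)) * indicator {..w} (- x) \<partial>lborel)"
    using nn_integral_real_affine[of "\<lambda>x. ennreal (std_normal_density x) * indicator {..w} x" "-1" 0]
    by simp
  also have "\<dots> = (\<integral>\<^sup>+x. ennreal (std_normal_density x) * indicator {- w..} x \<partial>lborel)"
    by (intro nn_integral_cong) (auto simp: std_normal_density_def indicator_def)
  also have "\<dots> = emeasure std_normal_distribution {- w..}"
    by (subst emeasure_density) auto
  finally show ?thesis by (simp add: measure_def)
qed

lemma std_normal_density_ge_inside_unit:
  assumes "\<bar>w\<bar> \<le> 1"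
  shows "1 / 5 \<le> std_normal_density w"
proof -
  have "w\<^sup>2 \<le> 1" using assms by (simp add: abs_square_le_1)
  \<comment> \<open>The product of the two rational bounds is \<open>117/25\<close>, just below 5.\<close>
  have "sqrt (2 * pi) \<le> sqrt ((13/5)\<^sup>2)"
    using pi_less_4 pi_approx by (intro real_sqrt_le_mono) (simp add: power2_eq_square)
  then have s: "sqrt (2 * pi) \<le> 13/5" by simp
  have "exp (1/2::real) \<le> sqrt 3"
    using exp_le by (intro real_le_rsqrt) (simp add: power2_eq_square flip: exp_add)
  also have "sqrt 3 \<le> sqrt ((9/5)\<^sup>2)" by (intro real_sqrt_le_mono) (simp add: power2_eq_square)
  finally have e: "exp (1/2::real) \<le> 9/5" by simp
  have "sqrt (2 * pi) * exp (w\<^sup>2 / 2) \<le> (13/5) * (9/5)"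
    using s e \<open>w\<^sup>2 \<le> 1\<close> by (intro mult_mono order_trans[OF _ e]) auto
  also have "\<dots> \<le> 5" by simp
  finally have "sqrt (2 * pi) * exp (w\<^sup>2 / 2) \<le> 5" .
  then have "1 / 5 \<le> 1 / (sqrt (2 * pi) * exp (w\<^sup>2 / 2))"
    by (intro divide_left_mono) auto
  then show ?thesis by (simp add: std_normal_density_def exp_minus field_simps)
qed

text \<open>The solution is \<open>f(w) = (1 / \<phi>(w)) * (integral of (g - N g) \<phi> over (-\<infinity>, w])\<close>.
  The integrand is at most \<open>2 \<phi>\<close> and has total integral zero, so the numerator is at most twice
  the smaller of the two tails.  Mills' inequality then gives \<open>\<bar>w f(w)\<bar> \<le> 2\<close>, hence
  \<open>\<bar>f'(w)\<bar> \<le> 2 + 2\<close> from the equation; it also bounds \<open>f\<close> outside the unit interval, while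
  inside it the density is at least \<open>1/5\<close> and the smaller tail at most \<open>1/2\<close>.\<close>

lemma stein_equation_solution:
  fixes g :: "real \<Rightarrow> real"
  assumes cont: "continuous_on UNIV g" and bnd: "\<And>x. \<bar>g x\<bar> \<le> 1"
  obtains f f' :: "real \<Rightarrow> real"
  where "\<And>x. (f has_real_derivative f' x) (at x)"
    and "\<And>x. f' x = x * f x + (g x - normal_mean g)"
    and "\<And>x. \<bar>f x\<bar> \<le> 5" and "\<And>x. \<bar>f' x\<bar> \<le> 4"
proof -
  let ?N = std_normal_distribution
  interpret N: prob_space ?N
    by (rule prob_space_normal_density) simp
  have gm[measurable]: "g \<in> borel_measurable borel"
    using cont by (rule borel_measurable_continuous_onI)
  define c where "c = normal_mean g"
  define k where "k = (\<lambda>x. g x - c)"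
  have km[measurable]: "k \<in> borel_measurable borel" unfolding k_def by measurable
  have "\<bar>c\<bar> \<le> 1" unfolding c_def by (rule abs_normal_mean_le) (use bnd in auto)
  then have k2: "\<bar>k x\<bar> \<le> 2" for x using bnd[of x] unfolding k_def by linarith
  have kint: "integrable ?N k" by (rule integrable_std_normal_bounded[OF km k2])
  have k0: "(\<integral>x. k x \<partial>?N) = 0"
    unfolding k_def using integrable_std_normal_bounded[OF gm bnd]
    by (subst Bochner_Integration.integral_diff)
      (auto simp: c_def normal_mean_def N.prob_space simp del: space_density)
  define p where "p = (\<lambda>x. std_normal_density x * k x)"
  have pint: "integrable lborel p"
    using kint unfolding p_def by (subst (asm) integrable_density) auto
  have pset: "set_integrable lborel S p" if "S \<in> sets borel" for S
    unfolding set_integrable_def using that pint by (intro integrable_mult_indicator) auto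
  have pcont: "continuous_on UNIV p"
    unfolding p_def k_def std_normal_density_def by (intro continuous_intros cont) auto
  define F where "F = (\<lambda>w. LINT x:{..w}|lborel. p x)"
  have F_N: "F w = (\<integral>x. indicator {..w} x * k x \<partial>?N)" for w
    unfolding F_def p_def set_lebesgue_integral_def
    by (subst integral_density) (auto intro!: Bochner_Integration.integral_cong)
  have F_lower: "\<bar>F w\<bar> \<le> 2 * measure ?N {..w}" for w
  proof -
    have "\<bar>F w\<bar> \<le> (\<integral>x. \<bar>indicator {..w} x * k x\<bar> \<partial>?N)"
      unfolding F_N by (rule integral_abs_bound)
    also have "\<dots> \<le> (\<integral>x. 2 * indicator {..w} x \<partial>?N)"
      by (intro integral_mono integrable_std_normal_bounded[where C=2])
        (use k2 in \<open>auto simp: indicator_def\<close>)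
    finally show ?thesis by simp
  qed
  have F_upper: "\<bar>F w\<bar> \<le> 2 * measure ?N {w<..}" for w
  proof -
    have "F w = - (\<integral>x. indicator {w<..} x * k x \<partial>?N)"
    proof -
      have "(\<integral>x. indicator {..w} x * k x \<partial>?N) + (\<integral>x. indicator {w<..} x * k x \<partial>?N)
          = (\<integral>x. indicator {..w} x * k x + indicator {w<..} x * k x \<partial>?N)"
        by (intro Bochner_Integration.integral_add[symmetric]
            integrable_std_normal_bounded[where C=2])
          (use k2 in \<open>auto simp: indicator_def\<close>)
      also have "\<dots> = (\<integral>x. k x \<partial>?N)"
        by (intro Bochner_Integration.integral_cong) (auto simp: indicator_def)
      finally show ?thesis unfolding F_N k0 by linarith
    qed
    then have "\<bar>F w\<bar> \<le> (\<integral>x. \<bar>indicator {w<..} x * k x\<bar> \<partial>?N)"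
      by (metis abs_minus_cancel integral_abs_bound)
    also have "\<dots> \<le> (\<integral>x. 2 * indicator {w<..} x \<partial>?N)"
      by (intro integral_mono integrable_std_normal_bounded[where C=2])
        (use k2 in \<open>auto simp: indicator_def\<close>)
    finally show ?thesis by simp
  qed
  have F_one: "\<bar>F w\<bar> \<le> 1" for w
  proof -
    have "{w<..} = space ?N - {..w}" by auto
    then have "measure ?N {w<..} = 1 - measure ?N {..w}"
      by (metis N.prob_compl borel_closed closed_atMost sets_density sets_lborel)
    then show ?thesis using F_lower[of w] F_upper[of w] by linarith
  qed
  have F_mills: "\<bar>w * F w\<bar> \<le> 2 * std_normal_density w" for w
  proof (cases "0 \<le> w")
    case True
    have "\<bar>F w\<bar> \<le> 2 * measure ?N {w..}"
      by (rule order_trans[OF F_upper]) (auto intro!: N.finite_measure_mono)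
    then have "w * \<bar>F w\<bar> \<le> w * (2 * measure ?N {w..})"
      using True by (rule mult_left_mono)
    then show ?thesis using True std_normal_upper_tail_le[OF True] by (simp add: abs_mult)
  next
    case False
    have "std_normal_density (- w) = std_normal_density w"
      by (simp add: std_normal_density_def)
    moreover have "(- w) * \<bar>F w\<bar> \<le> (- w) * (2 * measure ?N {- w..})"
      using False F_lower[of w] by (intro mult_left_mono) (auto simp: std_normal_lower_tail_eq)
    moreover have "(- w) * measure ?N {- w..} \<le> std_normal_density (- w)"
      using False by (intro std_normal_upper_tail_le) simp
    moreover have "\<bar>w * F w\<bar> = (- w) * \<bar>F w\<bar>"
      using False by (simp add: abs_mult)
    ultimately show ?thesis by linarith
  qed
  have F_deriv: "(F has_real_derivative p w) (at w)" for w
  proof -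
    have eq: "F x = F (w - 1) + integral {w - 1..x} p" if "x \<in> {w - 1..w + 1}" for x
    proof -
      have split: "{..x} = {..w - 1} \<union> {w - 1<..x}" using that by auto
      have "F x = F (w - 1) + (LINT x:{w - 1<..x}|lborel. p x)"
        unfolding F_def split
        by (rule set_integral_Un) (auto intro!: pset)
      also have "(LINT x:{w - 1<..x}|lborel. p x) = (LINT x:{w - 1..x}|lborel. p x)"
        by (rule set_integral_cong_set)
          (auto simp: set_borel_measurable_def p_def intro!: AE_I[where N="{w - 1}"])
      also have "\<dots> = integral {w - 1..x} p"
        by (rule set_borel_integral_eq_integral)
          (auto intro!: pset)
      finally show ?thesis .
    qed
    have "((\<lambda>x. integral {w - 1..x} p) has_real_derivative p w) (at w within {w - 1..w + 1})"
      by (intro integral_has_real_derivative continuous_on_subset[OF pcont]) auto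
    then have "((\<lambda>x. F (w - 1) + integral {w - 1..x} p) has_real_derivative p w)
        (at w within {w - 1..w + 1})"
      by (auto intro!: derivative_eq_intros)
    then have "(F has_real_derivative p w) (at w within {w - 1..w + 1})"
      by (rule has_field_derivative_transform_within[OF _ zero_less_one])
        (simp, rule eq[symmetric])
    moreover have "at w within {w - 1..w + 1} = at w" by (rule at_within_interior) simp
    ultimately show ?thesis by (simp only:)
  qed
  define f where "f = (\<lambda>w. F w / std_normal_density w)"
  define f' where "f' = (\<lambda>w. w * f w + (g w - normal_mean g))"
  have pos: "0 < std_normal_density w" for w by (simp add: normal_density_pos)
  have wf: "\<bar>w * f w\<bar> \<le> 2" for w
    using F_mills[of w] pos[of w] by (simp add: f_def abs_mult divide_le_eq)
  show ?thesis
  proof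
    show "(f has_real_derivative f' x) (at x)" for x
      unfolding f_def f'_def using pos[of x]
      by (auto intro!: derivative_eq_intros F_deriv std_normal_density_has_derivative
          simp: p_def k_def c_def field_simps)
    show "f' x = x * f x + (g x - normal_mean g)" for x by (simp add: f'_def)
    show "\<bar>f x\<bar> \<le> 5" for x
    proof (cases "\<bar>x\<bar> \<le> 1")
      case True
      have "\<bar>F x\<bar> \<le> 5 * std_normal_density x"
        using F_one[of x] std_normal_density_ge_inside_unit[OF True] by linarith
      then show ?thesis using pos[of x] by (simp add: f_def divide_le_eq)
    next
      case False
      then have "1 * \<bar>f x\<bar> \<le> \<bar>x\<bar> * \<bar>f x\<bar>" by (intro mult_right_mono) auto
      then show ?thesis using wf[of x] by (simp add: abs_mult)
    qed
    show "\<bar>f' x\<bar> \<le> 4" for x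
      using wf[of x] k2[of x] unfolding f'_def k_def c_def by linarith
  qed
qed

section \<open>Smoothing by moving averages\<close>

definition moving_average :: "real \<Rightarrow> (real \<Rightarrow> real) \<Rightarrow> real \<Rightarrow> real" where
  "moving_average t h x = integral {x - t..x + t} h / (2 * t)"

lemma bounded_borel_integrable_on_Icc:
  fixes h :: "real \<Rightarrow> real"
  assumes "h \<in> borel_measurable borel" "\<And>x. \<bar>h x\<bar> \<le> C"
  shows "h integrable_on {a..b}"
proof (rule set_borel_integral_eq_integral(1))
  show "set_integrable lborel {a..b} h"
    unfolding set_integrable_def
    using assms
    by (intro integrableI_bounded_set[of "{a..b}" _ _ C])
      (auto simp: indicator_def emeasure_lborel_Icc_eq)
qed

lemma integral_Icc_bounds:
  fixes h :: "real \<Rightarrow> real"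
  assumes "h integrable_on {a..b}" "a \<le> b" "\<And>x. x \<in> {a..b} \<Longrightarrow> m \<le> h x \<and> h x \<le> C"
  shows "(b - a) * m \<le> integral {a..b} h \<and> integral {a..b} h \<le> (b - a) * C"
proof -
  have const: "(\<lambda>_. k) integrable_on {a..b}" for k :: real by (rule integrable_const_ivl)
  have "integral {a..b} (\<lambda>_. m) \<le> integral {a..b} h"
    by (rule integral_le[OF const assms(1)]) (use assms(3) in auto)
  moreover have "integral {a..b} h \<le> integral {a..b} (\<lambda>_. C)"
    by (rule integral_le[OF assms(1) const]) (use assms(3) in auto)
  ultimately show ?thesis using assms(2) by (simp add: mult.commute)
qed

context
  fixes h :: "real \<Rightarrow> real" and t :: real
  assumes h_meas: "h \<in> borel_measurable borel" and h_bound: "\<And>x. \<bar>h x\<bar> \<le> 1"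
    and t_pos: "0 < t"
begin

lemmas h_integrable = bounded_borel_integrable_on_Icc[OF h_meas h_bound]

lemma moving_average_bounds:
  assumes "\<And>y. \<bar>y - x\<bar> \<le> t \<Longrightarrow> m \<le> h y \<and> h y \<le> C"
  shows "m \<le> moving_average t h x \<and> moving_average t h x \<le> C"
proof -
  have "m \<le> h y \<and> h y \<le> C" if "y \<in> {x - t..x + t}" for y
    using that by (intro assms) auto
  then have "(x + t - (x - t)) * m \<le> integral {x - t..x + t} h \<and>
      integral {x - t..x + t} h \<le> (x + t - (x - t)) * C"
    using t_pos by (intro integral_Icc_bounds h_integrable) auto
  then show ?thesis
    using t_pos by (auto simp: moving_average_def field_simps)
qed

lemma abs_moving_average_le: "\<bar>moving_average t h x\<bar> \<le> 1"
proof -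
  have "- 1 \<le> moving_average t h x \<and> moving_average t h x \<le> 1"
    using h_bound by (intro moving_average_bounds) (auto simp: abs_le_iff minus_le_iff)
  then show ?thesis by auto
qed

text \<open>Shifting the window by \<open>d\<close> adds one interval of length \<open>d\<close> and removes another one.
  The mean of \<open>h\<close> over each of the two lies in \<open>[m, C]\<close>, so the integral over the window changes
  by at most \<open>d (C - m)\<close>.  This holds for every \<open>d \<ge> 0\<close>, even if the two windows are disjoint.\<close>

lemma moving_average_diff_le:
  assumes "x \<le> y" and "\<And>z. x - t \<le> z \<Longrightarrow> z \<le> y + t \<Longrightarrow> m \<le> h z \<and> h z \<le> C"
  shows "\<bar>moving_average t h y - moving_average t h x\<bar> \<le> (y - x) * (C - m) / (2 * t)"
proof -
  have "integral {x - t..y - t} h + integral {y - t..y + t} h = integral {x - t..y + t} h"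
    "integral {x - t..x + t} h + integral {x + t..y + t} h = integral {x - t..y + t} h"
    using assms(1) t_pos by (intro Henstock_Kurzweil_Integration.integral_combine h_integrable; simp)+
  then have "integral {y - t..y + t} h - integral {x - t..x + t} h
      = integral {x + t..y + t} h - integral {x - t..y - t} h" by linarith
  moreover have "(y + t - (x + t)) * m \<le> integral {x + t..y + t} h \<and>
      integral {x + t..y + t} h \<le> (y + t - (x + t)) * C"
    using assms t_pos by (intro integral_Icc_bounds h_integrable) auto
  moreover have "(y - t - (x - t)) * m \<le> integral {x - t..y - t} h \<and>
      integral {x - t..y - t} h \<le> (y - t - (x - t)) * C"
    using assms t_pos by (intro integral_Icc_bounds h_integrable) auto
  moreover have "y + t - (x + t) = y - x" "y - t - (x - t) = y - x" by simp_all
  ultimately have "\<bar>integral {y - t..y + t} h - integral {x - t..x + t} h\<bar> \<le> (y - x) * C - (y - x) * m"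
    by (simp only: abs_le_iff) linarith
  then have "\<bar>integral {y - t..y + t} h - integral {x - t..x + t} h\<bar> \<le> (y - x) * (C - m)"
    by (simp only: right_diff_distrib)
  then have "\<bar>integral {y - t..y + t} h - integral {x - t..x + t} h\<bar> / (2 * t)
      \<le> (y - x) * (C - m) / (2 * t)"
    using t_pos by (intro divide_right_mono) auto
  then show ?thesis
    using t_pos by (simp add: moving_average_def abs_divide flip: diff_divide_distrib)
qed

lemma moving_average_diff_le_abs:
  assumes "\<bar>y - x\<bar> \<le> d" and "\<And>z. \<bar>z - x\<bar> \<le> t + d \<Longrightarrow> m \<le> h z \<and> h z \<le> C"
  shows "\<bar>moving_average t h y - moving_average t h x\<bar> \<le> \<bar>y - x\<bar> * (C - m) / (2 * t)"
proof (cases "x \<le> y")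
  case True
  with assms have "\<bar>moving_average t h y - moving_average t h x\<bar> \<le> (y - x) * (C - m) / (2 * t)"
    by (intro moving_average_diff_le) auto
  then show ?thesis using True by simp
next
  case False
  with assms have "\<bar>moving_average t h x - moving_average t h y\<bar> \<le> (x - y) * (C - m) / (2 * t)"
    by (intro moving_average_diff_le) auto
  then show ?thesis using False by (simp add: abs_minus_commute)
qed

lemma continuous_moving_average: "continuous_on UNIV (moving_average t h)"
proof (rule continuous_on_iff[THEN iffD2], intro ballI allI impI)
  fix x e :: real assume "0 < e"
  have "dist (moving_average t h y) (moving_average t h x) < e" if "dist y x < e * t" for y
  proof -
    have "\<bar>moving_average t h y - moving_average t h x\<bar> \<le> \<bar>y - x\<bar> * (1 - (-1)) / (2 * t)"
      using h_bound by (intro moving_average_diff_le_abs[of _ _ "\<bar>y - x\<bar>"])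
        (auto simp: abs_le_iff minus_le_iff)
    also have "\<dots> < e" using that t_pos by (simp add: dist_real_def field_simps)
    finally show ?thesis by (simp add: dist_real_def)
  qed
  then show "\<exists>d>0. \<forall>y\<in>UNIV. dist y x < d \<longrightarrow> dist (moving_average t h y) (moving_average t h x) < e"
    using \<open>0 < e\<close> t_pos by (intro exI[of _ "e * t"]) auto
qed

end

section \<open>Envelopes\<close>

lemma upper_env_upper:
  assumes "\<And>x. \<bar>h x\<bar> \<le> C" "\<bar>y - x\<bar> \<le> \<epsilon>"
  shows "h y \<le> upper_env \<epsilon> h x"
proof -
  have "bdd_above ((\<lambda>y. h (x + y)) ` {y. \<bar>y\<bar> \<le> \<epsilon>})"
    using assms(1) by (intro bdd_aboveI[of _ C]) (auto simp: abs_le_iff)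
  then have "h (x + (y - x)) \<le> upper_env \<epsilon> h x"
    unfolding upper_env_def using assms(2) by (intro cSUP_upper) auto
  then show ?thesis by simp
qed

lemma lower_env_lower:
  assumes "\<And>x. \<bar>h x\<bar> \<le> C" "\<bar>y - x\<bar> \<le> \<epsilon>"
  shows "lower_env \<epsilon> h x \<le> h y"
proof -
  have "bdd_below ((\<lambda>y. h (x + y)) ` {y. \<bar>y\<bar> \<le> \<epsilon>})"
    using assms(1) by (intro bdd_belowI[of _ "- C"]) (auto simp: abs_le_iff minus_le_iff)
  then have "lower_env \<epsilon> h x \<le> h (x + (y - x))"
    unfolding lower_env_def using assms(2) by (intro cINF_lower) auto
  then show ?thesis by simp
qed

lemma upper_env_least:
  assumes "0 \<le> \<epsilon>" "\<And>y. \<bar>y - x\<bar> \<le> \<epsilon> \<Longrightarrow> h y \<le> m"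
  shows "upper_env \<epsilon> h x \<le> m"
  unfolding upper_env_def using assms by (intro cSUP_least) (auto intro: exI[of _ 0])

lemma lower_env_greatest:
  assumes "0 \<le> \<epsilon>" "\<And>y. \<bar>y - x\<bar> \<le> \<epsilon> \<Longrightarrow> m \<le> h y"
  shows "m \<le> lower_env \<epsilon> h x"
  unfolding lower_env_def using assms by (intro cINF_greatest) (auto intro: exI[of _ 0])

lemma upper_env_nested:
  assumes "\<And>x. \<bar>h x\<bar> \<le> C" "0 \<le> s" "\<bar>y - x\<bar> + s \<le> r"
  shows "upper_env s h y \<le> upper_env r h x"
  using assms by (intro upper_env_least upper_env_upper[where C=C]) auto

lemma lower_env_nested:
  assumes "\<And>x. \<bar>h x\<bar> \<le> C" "0 \<le> s" "\<bar>y - x\<bar> + s \<le> r"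
  shows "lower_env r h x \<le> lower_env s h y"
  using assms by (intro lower_env_greatest lower_env_lower[where C=C]) auto

section \<open>Bounded size bias couplings\<close>

lemma first_order_remainder_le:
  fixes f f' :: "real \<Rightarrow> real"
  assumes deriv: "\<And>x. (f has_real_derivative f' x) (at x)"
    and osc: "\<And>z. \<bar>z - x\<bar> \<le> \<bar>y - x\<bar> \<Longrightarrow> \<bar>f' z - f' x\<bar> \<le> K"
  shows "\<bar>f y - f x - f' x * (y - x)\<bar> \<le> K * \<bar>y - x\<bar>"
proof -
  have "norm ((f y - f' x * y) - (f x - f' x * x)) \<le> K * norm (y - x)"
  proof (rule field_differentiable_bound[where S = "cball x \<bar>y - x\<bar>" and f' = "\<lambda>z. f' z - f' x"])
    show "((\<lambda>z. f z - f' x * z) has_real_derivative f' z - f' x) (at z within cball x \<bar>y - x\<bar>)" for z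
      by (rule has_field_derivative_at_within) (auto intro!: derivative_eq_intros deriv)
    show "norm (f' z - f' x) \<le> K" if "z \<in> cball x \<bar>y - x\<bar>" for z
      using that osc[of z] by (auto simp: dist_real_def abs_minus_commute)
  qed (auto simp: dist_real_def abs_minus_commute)
  then show ?thesis by (simp add: algebra_simps)
qed

locale bounded_size_bias_coupling = prob_space M for M :: "'a measure" +
  fixes Y Ys :: "'a \<Rightarrow> real" and \<mu> \<sigma> B :: real
  assumes Y_meas[measurable]: "Y \<in> borel_measurable M"
    and Y_nonneg: "AE \<omega> in M. Y \<omega> \<ge> 0"
    and Y_square: "integrable M (\<lambda>\<omega>. (Y \<omega>)\<^sup>2)"
    and Y_mean: "expectation Y = \<mu>"
    and Y_var: "variance Y = \<sigma>\<^sup>2"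
    and sigma_pos: "\<sigma> > 0"
    and size_bias: "has_size_biased_distribution M Ys M Y"
    and coupling_bound: "AE \<omega> in M. \<bar>Ys \<omega> - Y \<omega>\<bar> \<le> B"
begin

definition W :: "'a \<Rightarrow> real" where "W \<omega> = (Y \<omega> - \<mu>) / \<sigma>"

definition Ws :: "'a \<Rightarrow> real" where "Ws \<omega> = (Ys \<omega> - \<mu>) / \<sigma>"

definition G :: "'a \<Rightarrow> real" where "G = cond_exp_given M (\<lambda>\<omega>. Ys \<omega> - Y \<omega>) Y"

lemma Ys_meas[measurable]: "Ys \<in> borel_measurable M"
  using size_bias by (simp add: has_size_biased_distribution_def)

lemma W_meas[measurable]: "W \<in> borel_measurable M"
  unfolding W_def by measurable

lemma Ws_meas[measurable]: "Ws \<in> borel_measurable M"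
  unfolding Ws_def by measurable

lemma Y_integrable: "integrable M Y"
  using Y_meas Y_square by (rule square_integrable_imp_integrable)

lemma size_bias_expectation:
  assumes "f \<in> borel_measurable borel" "integrable M (\<lambda>\<omega>. Y \<omega> * f (Y \<omega>))"
  shows "integrable M (\<lambda>\<omega>. f (Ys \<omega>))"
    "expectation (\<lambda>\<omega>. Y \<omega> * f (Y \<omega>)) = \<mu> * expectation (\<lambda>\<omega>. f (Ys \<omega>))"
  using size_bias assms unfolding has_size_biased_distribution_def Y_mean by blast+

text \<open>The size bias identity for \<open>f(y) = y\<close> evaluates \<open>E Ys\<close>.  The value is what excludes \<open>\<mu> = 0\<close> and
  what makes \<open>(\<mu> / \<sigma>) (Ws - W)\<close> a variable of mean 1.\<close>

lemma Ys_integrable: "integrable M Ys"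
  and Ys_mean: "\<mu> * expectation Ys = \<sigma>\<^sup>2 + \<mu>\<^sup>2"
proof -
  have i: "integrable M (\<lambda>\<omega>. Y \<omega> * Y \<omega>)" using Y_square by (simp add: power2_eq_square)
  show "integrable M Ys" using size_bias_expectation(1)[of "\<lambda>y. y"] i by simp
  have "\<mu> * expectation Ys = expectation (\<lambda>\<omega>. (Y \<omega>)\<^sup>2)"
    using size_bias_expectation(2)[of "\<lambda>y. y"] i by (simp add: power2_eq_square)
  also have "\<dots> = \<sigma>\<^sup>2 + \<mu>\<^sup>2"
    using variance_eq[OF Y_integrable Y_square] Y_mean Y_var by simp
  finally show "\<mu> * expectation Ys = \<sigma>\<^sup>2 + \<mu>\<^sup>2" .
qed

lemma mu_pos: "0 < \<mu>"
proof -
  have "0 \<le> \<mu>" unfolding Y_mean[symmetric] by (rule integral_nonneg_AE) (rule Y_nonneg)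
  moreover have "\<mu> \<noteq> 0" using Ys_mean sigma_pos by auto
  ultimately show ?thesis by simp
qed

lemma mean_coupling_difference: "expectation (\<lambda>\<omega>. Ys \<omega> - Y \<omega>) = \<sigma>\<^sup>2 / \<mu>"
  using Ys_mean mu_pos Y_integrable Ys_integrable
  by (simp add: Y_mean field_simps power2_eq_square)

lemma difference_integrable: "integrable M (\<lambda>\<omega>. Ys \<omega> - Y \<omega>)"
  using Y_integrable Ys_integrable by simp

lemma variance_le_mean_times_bound: "\<sigma>\<^sup>2 \<le> \<mu> * B"
proof -
  have "expectation (\<lambda>\<omega>. Ys \<omega> - Y \<omega>) \<le> expectation (\<lambda>\<omega>. B)"
    using coupling_bound difference_integrable by (intro integral_mono_AE) auto
  then show ?thesis
    using mu_pos by (simp add: mean_coupling_difference prob_space field_simps)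
qed

lemma B_pos: "0 < B"
proof -
  have "0 < \<mu> * B" using variance_le_mean_times_bound sigma_pos by (meson less_le_trans zero_less_power)
  then show ?thesis using mu_pos by (simp add: zero_less_mult_iff)
qed

lemma W_integrable: "integrable M W"
  unfolding W_def using Y_integrable by simp

lemma mean_abs_W_le: "expectation (\<lambda>\<omega>. \<bar>W \<omega>\<bar>) \<le> 1"
proof -
  have sq: "integrable M (\<lambda>\<omega>. (W \<omega>)\<^sup>2)"
    unfolding W_def using Y_square Y_integrable by (simp add: power_divide power2_diff)
  have "expectation (\<lambda>\<omega>. (W \<omega>)\<^sup>2) = 1"
    using Y_var sigma_pos unfolding W_def Y_mean by (simp add: power_divide)
  moreover have "0 \<le> variance (\<lambda>\<omega>. \<bar>W \<omega>\<bar>)" by (rule variance_positive)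
  moreover have "variance (\<lambda>\<omega>. \<bar>W \<omega>\<bar>)
      = expectation (\<lambda>\<omega>. (W \<omega>)\<^sup>2) - (expectation (\<lambda>\<omega>. \<bar>W \<omega>\<bar>))\<^sup>2"
    using variance_eq[of "\<lambda>\<omega>. \<bar>W \<omega>\<bar>"] W_integrable sq by simp
  ultimately have "(expectation (\<lambda>\<omega>. \<bar>W \<omega>\<bar>))\<^sup>2 \<le> 1" by simp
  then show ?thesis by (simp add: abs_square_le_1 abs_le_iff)
qed

lemma integrable_bounded_real:
  fixes f :: "'a \<Rightarrow> real"
  assumes "f \<in> borel_measurable M" "\<And>\<omega>. \<bar>f \<omega>\<bar> \<le> C"
  shows "integrable M f"
  by (rule integrable_const_bound[of _ C]) (use assms in auto)

text \<open>For the standardized variable the size bias identity plays the role of the integration by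
  parts \<open>E Z f(Z) = E f'(Z)\<close> of the normal law: the derivative is replaced by a difference.\<close>

lemma size_bias_standardized:
  assumes [measurable]: "f \<in> borel_measurable borel" and bnd: "\<And>x. \<bar>f x\<bar> \<le> C"
  shows "integrable M (\<lambda>\<omega>. W \<omega> * f (W \<omega>))"
    "expectation (\<lambda>\<omega>. W \<omega> * f (W \<omega>)) = \<mu> / \<sigma> * expectation (\<lambda>\<omega>. f (Ws \<omega>) - f (W \<omega>))"
proof -
  define k where "k = (\<lambda>y. f ((y - \<mu>) / \<sigma>))"
  have [measurable]: "k \<in> borel_measurable borel" unfolding k_def by measurable
  have kW: "k (Y \<omega>) = f (W \<omega>)" "k (Ys \<omega>) = f (Ws \<omega>)" for \<omega>
    by (simp_all add: k_def W_def Ws_def)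
  have dom: "\<bar>Y \<omega> * k (Y \<omega>)\<bar> \<le> \<bar>C * Y \<omega>\<bar>" for \<omega>
    unfolding kW abs_mult mult.commute[of "\<bar>Y \<omega>\<bar>"] using bnd[of "W \<omega>"]
    by (intro mult_right_mono) auto
  have Yk: "integrable M (\<lambda>\<omega>. Y \<omega> * k (Y \<omega>))"
  proof (rule Bochner_Integration.integrable_bound)
    show "integrable M (\<lambda>\<omega>. C * Y \<omega>)" using Y_integrable by simp
    show "AE \<omega> in M. norm (Y \<omega> * k (Y \<omega>)) \<le> norm (C * Y \<omega>)"
      unfolding real_norm_def using dom by (intro AE_I2)
  qed measurable
  have Yf: "integrable M (\<lambda>\<omega>. Y \<omega> * f (W \<omega>))" using Yk by (simp only: kW)
  have iWs: "integrable M (\<lambda>\<omega>. f (Ws \<omega>))"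
    by (rule integrable_bounded_real[of _ C]) (use bnd in auto)
  have iW: "integrable M (\<lambda>\<omega>. f (W \<omega>))"
    by (rule integrable_bounded_real[of _ C]) (use bnd in auto)
  have eq: "W \<omega> * f (W \<omega>) = (Y \<omega> * f (W \<omega>) - \<mu> * f (W \<omega>)) / \<sigma>" for \<omega>
    by (simp add: W_def field_simps)
  show "integrable M (\<lambda>\<omega>. W \<omega> * f (W \<omega>))"
    unfolding eq
    by (intro integrable_divide_zero Bochner_Integration.integrable_diff integrable_mult_right Yf iW)
  have "expectation (\<lambda>\<omega>. W \<omega> * f (W \<omega>))
      = (expectation (\<lambda>\<omega>. Y \<omega> * f (W \<omega>)) - \<mu> * expectation (\<lambda>\<omega>. f (W \<omega>))) / \<sigma>"
    unfolding eq using Yf iW by simp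
  also have "expectation (\<lambda>\<omega>. Y \<omega> * f (W \<omega>)) = \<mu> * expectation (\<lambda>\<omega>. f (Ws \<omega>))"
    using size_bias_expectation(2)[of k] Yk by (simp only: kW) simp
  finally show "expectation (\<lambda>\<omega>. W \<omega> * f (W \<omega>))
      = \<mu> / \<sigma> * expectation (\<lambda>\<omega>. f (Ws \<omega>) - f (W \<omega>))"
    using iW iWs by (simp add: right_diff_distrib diff_divide_distrib)
qed

text \<open>A factor \<open>p(W)\<close> sees the difference \<open>Ys - Y\<close> only through its conditional
  expectation \<open>G\<close> given \<open>Y\<close>.  The mean of \<open>G\<close> is \<open>\<sigma>\<^sup>2 / \<mu>\<close>, so \<open>1 - (\<mu> / \<sigma>\<^sup>2) G\<close> is a
  multiple of the centered \<open>G\<close>, whose mean absolute value is at most its standard deviation.\<close>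

lemma conditional_mean_error_le:
  assumes [measurable]: "p \<in> borel_measurable borel" and bnd: "\<And>x. \<bar>p x\<bar> \<le> C"
  shows "\<bar>expectation (\<lambda>\<omega>. p (W \<omega>) * (1 - \<mu> / \<sigma> * (Ws \<omega> - W \<omega>)))\<bar>
    \<le> C * (\<mu> * sqrt (variance G) / \<sigma>\<^sup>2)"
proof -
  define F where "F = vimage_algebra (space M) Y borel"
  have "sets F \<subseteq> sets M"
    unfolding F_def sets_vimage_algebra by (rule sets.sigma_sets_subset) auto
  then have sub: "subalgebra M F" by (simp add: F_def subalgebra_def)
  interpret F: finite_measure_subalgebra M F
    by unfold_locales (rule sub)
  have G_def': "G = real_cond_exp M F (\<lambda>\<omega>. Ys \<omega> - Y \<omega>)"
    by (simp add: G_def cond_exp_given_def F_def)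
  have YF: "Y \<in> borel_measurable F" unfolding F_def by (rule measurable_vimage_algebra1) auto
  have G_meas[measurable]: "G \<in> borel_measurable M" unfolding G_def' by simp
  have "0 \<le> C" using bnd[of 0] by linarith
  have G_int: "integrable M G"
    unfolding G_def' by (rule F.real_cond_exp_int) (rule difference_integrable)
  have G_mean: "expectation G = \<sigma>\<^sup>2 / \<mu>"
    unfolding G_def' using F.real_cond_exp_int(2)[OF difference_integrable]
    by (simp add: mean_coupling_difference)
  have "AE \<omega> in M. G \<omega> \<le> B" "AE \<omega> in M. - B \<le> G \<omega>"
    unfolding G_def' using coupling_bound
    by (intro F.real_cond_exp_le_c[OF difference_integrable]
        F.real_cond_exp_ge_c[OF difference_integrable]; auto elim!: eventually_mono)+
  then have dev_bound: "AE \<omega> in M. norm (\<bar>G \<omega> - expectation G\<bar>) \<le> B + \<bar>expectation G\<bar>"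
    by eventually_elim auto
  define d where "d = (\<lambda>\<omega>. \<bar>G \<omega> - expectation G\<bar>)"
  have d_meas[measurable]: "d \<in> borel_measurable M" unfolding d_def by measurable
  have d_int: "integrable M d"
    unfolding d_def using G_int by simp
  have d_sq: "integrable M (\<lambda>\<omega>. (d \<omega>)\<^sup>2)"
  proof (rule integrable_const_bound[of _ "(B + \<bar>expectation G\<bar>)\<^sup>2"])
    show "AE \<omega> in M. norm ((d \<omega>)\<^sup>2) \<le> (B + \<bar>expectation G\<bar>)\<^sup>2"
      using dev_bound by eventually_elim (simp add: d_def flip: abs_le_square_iff)
  qed measurable
  have d_le: "expectation d \<le> sqrt (variance G)"
  proof (rule real_le_rsqrt)
    have "0 \<le> variance d" by (rule variance_positive)
    then show "(expectation d)\<^sup>2 \<le> variance G"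
      unfolding variance_eq[OF d_int d_sq] by (simp only: d_def power2_abs)
  qed
  define q where "q = (\<lambda>\<omega>. p (W \<omega>))"
  have qF: "q \<in> borel_measurable F"
    unfolding q_def W_def using YF by measurable
  have qM[measurable]: "q \<in> borel_measurable M" unfolding q_def by measurable
  have qb: "\<bar>q \<omega>\<bar> \<le> C" for \<omega> unfolding q_def by (rule bnd)
  have q_int: "integrable M q" by (rule integrable_bounded_real[of _ C]) (use qb in auto)
  have q_mult: "integrable M (\<lambda>\<omega>. q \<omega> * k \<omega>)" if k: "integrable M k" for k
  proof (rule Bochner_Integration.integrable_bound)
    show "integrable M (\<lambda>\<omega>. C * k \<omega>)" using k by simp
    have "\<bar>q \<omega>\<bar> * \<bar>k \<omega>\<bar> \<le> \<bar>C\<bar> * \<bar>k \<omega>\<bar>" for \<omega>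
      using qb[of \<omega>] by (intro mult_right_mono) auto
    then show "AE \<omega> in M. norm (q \<omega> * k \<omega>) \<le> norm (C * k \<omega>)"
      unfolding real_norm_def abs_mult by (intro AE_I2)
    show "(\<lambda>\<omega>. q \<omega> * k \<omega>) \<in> borel_measurable M"
      using borel_measurable_integrable[OF k] by measurable
  qed
  have cond: "expectation (\<lambda>\<omega>. q \<omega> * G \<omega>) = expectation (\<lambda>\<omega>. q \<omega> * (Ys \<omega> - Y \<omega>))"
    unfolding G_def'
    by (rule F.real_cond_exp_intg(2)[OF q_mult[OF difference_integrable] qF]) measurable
  have "expectation (\<lambda>\<omega>. p (W \<omega>) * (1 - \<mu> / \<sigma> * (Ws \<omega> - W \<omega>)))
      = expectation (\<lambda>\<omega>. q \<omega> - \<mu> / \<sigma>\<^sup>2 * (q \<omega> * (Ys \<omega> - Y \<omega>)))"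
    using sigma_pos by (intro Bochner_Integration.integral_cong)
      (auto simp: q_def W_def Ws_def field_simps power2_eq_square)
  also have "\<dots> = expectation q - \<mu> / \<sigma>\<^sup>2 * expectation (\<lambda>\<omega>. q \<omega> * G \<omega>)"
    using q_int q_mult[OF difference_integrable] cond by simp
  also have "\<dots> = expectation (\<lambda>\<omega>. q \<omega> - \<mu> / \<sigma>\<^sup>2 * (q \<omega> * G \<omega>))"
    using q_int q_mult[OF G_int] by simp
  also have "\<dots> = expectation (\<lambda>\<omega>. \<mu> / \<sigma>\<^sup>2 * (q \<omega> * (expectation G - G \<omega>)))"
    using sigma_pos mu_pos by (intro Bochner_Integration.integral_cong)
      (auto simp: G_mean field_simps)
  finally have "\<bar>expectation (\<lambda>\<omega>. p (W \<omega>) * (1 - \<mu> / \<sigma> * (Ws \<omega> - W \<omega>)))\<bar>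
      \<le> expectation (\<lambda>\<omega>. \<bar>\<mu> / \<sigma>\<^sup>2 * (q \<omega> * (expectation G - G \<omega>))\<bar>)"
    by (simp only: integral_abs_bound)
  also have "\<dots> \<le> expectation (\<lambda>\<omega>. \<mu> / \<sigma>\<^sup>2 * (C * d \<omega>))"
  proof (rule integral_mono)
    show "integrable M (\<lambda>\<omega>. \<bar>\<mu> / \<sigma>\<^sup>2 * (q \<omega> * (expectation G - G \<omega>))\<bar>)"
      using q_mult[of "\<lambda>\<omega>. expectation G - G \<omega>"] G_int by simp
    show "\<bar>\<mu> / \<sigma>\<^sup>2 * (q \<omega> * (expectation G - G \<omega>))\<bar> \<le> \<mu> / \<sigma>\<^sup>2 * (C * d \<omega>)" for \<omega>
      using qb[of \<omega>] mu_pos \<open>0 \<le> C\<close>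
      by (simp add: abs_mult d_def abs_minus_commute mult_left_mono mult_right_mono divide_right_mono)
  qed (use d_int in simp)
  also have "\<dots> = \<mu> / \<sigma>\<^sup>2 * (C * expectation d)" by simp
  also have "\<dots> \<le> \<mu> / \<sigma>\<^sup>2 * (C * sqrt (variance G))"
    using d_le mu_pos \<open>0 \<le> C\<close> by (intro mult_left_mono) auto
  finally show ?thesis by (simp add: mult.commute mult.left_commute)
qed

text \<open>Stein's equation turns \<open>E g(W) - N g\<close> into \<open>E f'(W) - E W f(W)\<close>, and the size bias
  identity turns \<open>E W f(W)\<close> into \<open>\<mu> / \<sigma>\<close> times \<open>E (f(Ws) - f(W))\<close>.  The linear part of this
  difference is the conditional mean error.  In the remainder \<open>f'\<close> varies over distance at most
  \<open>B / \<sigma>\<close>; by the equation the variation of \<open>f'\<close> is that of \<open>x f(x)\<close>, which the bounds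
  5 and 4 control, plus that of \<open>g\<close>.\<close>

lemma normal_approximation_of_continuous:
  assumes cont: "continuous_on UNIV g" and bnd: "\<And>x. \<bar>g x\<bar> \<le> 1"
    and q_meas[measurable]: "q \<in> borel_measurable borel" and q_bnd: "\<And>x. \<bar>q x\<bar> \<le> K"
    and osc: "\<And>x y. \<bar>y - x\<bar> \<le> B / \<sigma> \<Longrightarrow> \<bar>g y - g x\<bar> \<le> q x"
  shows "\<bar>expectation (\<lambda>\<omega>. g (W \<omega>)) - normal_mean g\<bar>
    \<le> \<mu> / \<sigma> * (B / \<sigma> * (9 * (B / \<sigma>) + expectation (\<lambda>\<omega>. q (W \<omega>))))
      + 4 * (\<mu> * sqrt (variance G) / \<sigma>\<^sup>2)"
proof -
  define A where "A = B / \<sigma>"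
  have "0 < A" unfolding A_def using B_pos sigma_pos by simp
  obtain f f' where deriv: "\<And>x. (f has_real_derivative f' x) (at x)"
    and stein: "\<And>x. f' x = x * f x + (g x - normal_mean g)"
    and f5: "\<And>x. \<bar>f x\<bar> \<le> 5" and f4: "\<And>x. \<bar>f' x\<bar> \<le> 4"
    using stein_equation_solution[OF cont bnd] by blast
  have gm[measurable]: "g \<in> borel_measurable borel"
    using cont by (rule borel_measurable_continuous_onI)
  have "continuous_on UNIV f"
    using deriv by (intro continuous_at_imp_continuous_on ballI) (rule DERIV_isCont)
  then have fm[measurable]: "f \<in> borel_measurable borel"
    by (rule borel_measurable_continuous_onI)
  have "f' = (\<lambda>x. x * f x + (g x - normal_mean g))" using stein by blast
  then have f'm[measurable]: "f' \<in> borel_measurable borel" by simp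
  define R where "R = (\<lambda>\<omega>. f (Ws \<omega>) - f (W \<omega>) - f' (W \<omega>) * (Ws \<omega> - W \<omega>))"
  have fdiff: "\<bar>f z - f x\<bar> \<le> 4 * \<bar>z - x\<bar>" for x z
    using field_differentiable_bound[of UNIV f f' 4 z x] deriv f4 by auto
  have f'diff: "\<bar>f' z - f' x\<bar> \<le> 5 * A + 4 * A * \<bar>x\<bar> + q x" if "\<bar>z - x\<bar> \<le> A" for x z
  proof -
    have "f' z - f' x = (z - x) * f z + x * (f z - f x) + (g z - g x)"
      by (simp add: stein algebra_simps)
    then have "\<bar>f' z - f' x\<bar> \<le> \<bar>z - x\<bar> * \<bar>f z\<bar> + \<bar>x\<bar> * \<bar>f z - f x\<bar> + \<bar>g z - g x\<bar>"
      by (simp only: abs_mult[symmetric])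
    also have "\<dots> \<le> A * 5 + \<bar>x\<bar> * (4 * A) + q x"
      using that f5[of z] fdiff[of z x] osc[of z x] \<open>0 < A\<close> unfolding A_def[symmetric]
      by (intro add_mono mult_mono) auto
    finally show ?thesis by (simp add: mult.commute)
  qed
  have R_le: "AE \<omega> in M. \<bar>R \<omega>\<bar> \<le> A * (5 * A + 4 * A * \<bar>W \<omega>\<bar> + q (W \<omega>))"
    using coupling_bound
  proof eventually_elim
    case (elim \<omega>)
    have "\<bar>Ws \<omega> - W \<omega>\<bar> = \<bar>Ys \<omega> - Y \<omega>\<bar> / \<sigma>"
      using sigma_pos by (simp add: W_def Ws_def abs_divide flip: diff_divide_distrib)
    also have "\<dots> \<le> A" unfolding A_def using elim sigma_pos by (intro divide_right_mono) auto
    finally have le: "\<bar>Ws \<omega> - W \<omega>\<bar> \<le> A" .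
    have "\<bar>R \<omega>\<bar> \<le> (5 * A + 4 * A * \<bar>W \<omega>\<bar> + q (W \<omega>)) * \<bar>Ws \<omega> - W \<omega>\<bar>"
      unfolding R_def using le by (intro first_order_remainder_le deriv f'diff) linarith
    also have "\<dots> \<le> (5 * A + 4 * A * \<bar>W \<omega>\<bar> + q (W \<omega>)) * A"
      using le f'diff[of "W \<omega>" "W \<omega>"] \<open>0 < A\<close> by (intro mult_left_mono) auto
    finally show ?case by (simp add: mult.commute)
  qed
  have q_int: "integrable M (\<lambda>\<omega>. q (W \<omega>))"
    by (rule integrable_bounded_real[of _ K]) (use q_bnd in auto)
  have bound_int: "integrable M (\<lambda>\<omega>. A * (5 * A + 4 * A * \<bar>W \<omega>\<bar> + q (W \<omega>)))"
    using W_integrable q_int by simp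
  have [measurable]: "R \<in> borel_measurable M" unfolding R_def by measurable
  have R_int: "integrable M R"
    by (rule Bochner_Integration.integrable_bound[OF bound_int])
      (use R_le in \<open>auto elim!: eventually_mono\<close>)
  have R_mean: "\<bar>expectation R\<bar> \<le> A * (9 * A + expectation (\<lambda>\<omega>. q (W \<omega>)))"
  proof -
    have "\<bar>expectation R\<bar> \<le> expectation (\<lambda>\<omega>. \<bar>R \<omega>\<bar>)" by (rule integral_abs_bound)
    also have "\<dots> \<le> expectation (\<lambda>\<omega>. A * (5 * A + 4 * A * \<bar>W \<omega>\<bar> + q (W \<omega>)))"
      using R_int bound_int R_le by (intro integral_mono_AE) auto
    also have "\<dots> = A * (5 * A + 4 * A * expectation (\<lambda>\<omega>. \<bar>W \<omega>\<bar>) + expectation (\<lambda>\<omega>. q (W \<omega>)))"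
      using W_integrable q_int by (simp add: prob_space)
    also have "\<dots> \<le> A * (5 * A + 4 * A * 1 + expectation (\<lambda>\<omega>. q (W \<omega>)))"
      using mean_abs_W_le \<open>0 < A\<close> by (intro mult_left_mono add_mono order_refl) auto
    finally show ?thesis by simp
  qed
  have f_W: "integrable M (\<lambda>\<omega>. f (W \<omega>))" "integrable M (\<lambda>\<omega>. f (Ws \<omega>))"
    using f5 by (auto intro!: integrable_bounded_real[of _ 5])
  have f'_W: "integrable M (\<lambda>\<omega>. f' (W \<omega>))"
    using f4 by (auto intro!: integrable_bounded_real[of _ 4])
  have g_W: "integrable M (\<lambda>\<omega>. g (W \<omega>))"
    using bnd by (auto intro!: integrable_bounded_real[of _ 1])
  define T where "T = (\<lambda>\<omega>. f' (W \<omega>) * (1 - \<mu> / \<sigma> * (Ws \<omega> - W \<omega>)))"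
  have T_eq: "T \<omega> = f' (W \<omega>) - \<mu> / \<sigma> * (f (Ws \<omega>) - f (W \<omega>)) + \<mu> / \<sigma> * R \<omega>" for \<omega>
    unfolding T_def R_def by (simp add: algebra_simps)
  have T_int: "integrable M T"
    unfolding T_eq[abs_def] using f_W f'_W R_int by simp
  have "expectation (\<lambda>\<omega>. g (W \<omega>)) - normal_mean g
      = expectation (\<lambda>\<omega>. f' (W \<omega>) - W \<omega> * f (W \<omega>))"
    using g_W by (simp add: stein prob_space)
  also have "\<dots> = expectation (\<lambda>\<omega>. f' (W \<omega>))
      - \<mu> / \<sigma> * expectation (\<lambda>\<omega>. f (Ws \<omega>) - f (W \<omega>))"
    using f'_W size_bias_standardized[OF fm f5] by simp
  also have "\<dots> = expectation T - \<mu> / \<sigma> * expectation R"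
    unfolding T_eq[abs_def] using f_W f'_W R_int by (simp add: algebra_simps)
  finally have "\<bar>expectation (\<lambda>\<omega>. g (W \<omega>)) - normal_mean g\<bar>
      \<le> \<bar>expectation T\<bar> + \<bar>\<mu> / \<sigma> * expectation R\<bar>" by linarith
  also have "\<bar>\<mu> / \<sigma> * expectation R\<bar> \<le> \<mu> / \<sigma> * (A * (9 * A + expectation (\<lambda>\<omega>. q (W \<omega>))))"
  proof -
    have "\<bar>\<mu> / \<sigma> * expectation R\<bar> = \<mu> / \<sigma> * \<bar>expectation R\<bar>"
      using mu_pos sigma_pos by (simp add: abs_mult)
    then show ?thesis using R_mean mu_pos sigma_pos by (simp only:) (intro mult_left_mono; simp)
  qed
  also have "\<bar>expectation T\<bar> \<le> 4 * (\<mu> * sqrt (variance G) / \<sigma>\<^sup>2)"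
    unfolding T_def by (rule conditional_mean_error_le[OF f'm f4])
  finally show ?thesis unfolding A_def by linarith
qed

end

section \<open>The error over a test class\<close>

lemma test_classD:
  assumes "test_class H a" "h \<in> H"
  shows "h \<in> borel_measurable borel" "\<bar>h x\<bar> \<le> 1"
    and "0 < \<epsilon> \<Longrightarrow> upper_env \<epsilon> h \<in> H" "0 < \<epsilon> \<Longrightarrow> lower_env \<epsilon> h \<in> H"
  using assms unfolding test_class_def by blast+

lemma normal_mean_diff:
  assumes "h \<in> borel_measurable borel" "\<And>x. \<bar>h x\<bar> \<le> C"
    and "k \<in> borel_measurable borel" "\<And>x. \<bar>k x\<bar> \<le> D"
  shows "normal_mean (\<lambda>x. h x - k x) = normal_mean h - normal_mean k"
  unfolding normal_mean_def
  by (intro Bochner_Integration.integral_diff integrable_std_normal_bounded[where C=C]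
      integrable_std_normal_bounded[where C=D] assms)

lemma test_class_oscillation:
  assumes H: "test_class H a" and h: "h \<in> H" and "0 < \<epsilon>"
  shows "normal_mean (upper_env \<epsilon> h) - normal_mean (lower_env \<epsilon> h) \<le> a * \<epsilon>"
proof -
  note u = test_classD(3)[OF H h \<open>0 < \<epsilon>\<close>] and l = test_classD(4)[OF H h \<open>0 < \<epsilon>\<close>]
  have "normal_mean (\<lambda>x. upper_env \<epsilon> h x - lower_env \<epsilon> h x) \<le> a * \<epsilon>"
    using assms unfolding test_class_def by blast
  then show ?thesis
    by (simp add: normal_mean_diff[OF test_classD(1,2)[OF H u] test_classD(1,2)[OF H l]])
qed

text \<open>An oscillation is nonnegative.  The sign of \<open>a\<close> matters when the coefficients \<open>18 + 9 a\<close> and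
  \<open>19 + 56 a\<close> are compared.\<close>

lemma test_class_nonneg:
  assumes H: "test_class H a" and h: "h \<in> H"
  shows "0 \<le> a"
proof -
  note u = test_classD(3)[OF H h zero_less_one] and l = test_classD(4)[OF H h zero_less_one]
  have "lower_env 1 h x \<le> upper_env 1 h x" for x
    by (rule order_trans[OF lower_env_lower[of h 1 x x 1, OF test_classD(2)[OF H h]]
          upper_env_upper[of h 1 x x 1, OF test_classD(2)[OF H h]]]) auto
  then have "normal_mean (lower_env 1 h) \<le> normal_mean (upper_env 1 h)"
    by (intro normal_mean_mono[OF test_classD(1,2)[OF H l] test_classD(1,2)[OF H u]])
  then show ?thesis using test_class_oscillation[OF H h zero_less_one] by simp
qed

lemma normal_distance_le_of_superset:
  "H \<subseteq> K \<Longrightarrow> normal_distance M W K \<le> c \<Longrightarrow> normal_distance M W H \<le> c"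
  unfolding normal_distance_def by (meson SUP_subset_mono order_refl order_trans)

context bounded_size_bias_coupling
begin

definition error :: "(real \<Rightarrow> real) \<Rightarrow> real" where
  "error h = expectation (\<lambda>\<omega>. h (W \<omega>)) - normal_mean h"

lemma integrable_test:
  fixes h :: "real \<Rightarrow> real"
  assumes "h \<in> borel_measurable borel" "\<And>x. \<bar>h x\<bar> \<le> C"
  shows "integrable M (\<lambda>\<omega>. h (W \<omega>))"
proof (rule integrable_bounded_real)
  show "(\<lambda>\<omega>. h (W \<omega>)) \<in> borel_measurable M"
    using assms(1) by measurable
qed (rule assms(2))

lemma abs_error_le_2:
  assumes "h \<in> borel_measurable borel" "\<And>x. \<bar>h x\<bar> \<le> 1"
  shows "\<bar>error h\<bar> \<le> 2"
proof -
  have "\<bar>expectation (\<lambda>\<omega>. h (W \<omega>))\<bar> \<le> expectation (\<lambda>\<omega>. \<bar>h (W \<omega>)\<bar>)"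
    by (rule integral_abs_bound)
  also have "\<dots> \<le> expectation (\<lambda>\<omega>. 1)"
    using integrable_test[OF assms] assms(2) by (intro integral_mono) auto
  finally have "\<bar>expectation (\<lambda>\<omega>. h (W \<omega>))\<bar> \<le> 1" by (simp add: prob_space)
  then show ?thesis unfolding error_def using abs_normal_mean_le[OF assms] by linarith
qed

text \<open>A moving average of \<open>h\<close> over \<open>[x - t, x + t]\<close> changes over a distance at most \<open>B / \<sigma>\<close> by
  at most \<open>B / (2 t \<sigma>)\<close> times the oscillation of \<open>h\<close> on radius \<open>t + B / \<sigma>\<close>.  The envelopes of
  \<open>h\<close> belong to the class, so the mean of that oscillation at \<open>W\<close> differs from the mean under the
  normal law by at most \<open>2 D\<close>: the error over the whole class comes back, damped by the
  smoothing.\<close>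

lemma error_moving_average_le:
  assumes H: "test_class H a" and h: "h \<in> H" and t: "0 < t"
    and D: "\<And>k. k \<in> H \<Longrightarrow> \<bar>error k\<bar> \<le> D"
  shows "\<bar>error (moving_average t h)\<bar>
    \<le> \<mu> / \<sigma> * (B / \<sigma> * (9 * (B / \<sigma>) + B / \<sigma> / (2 * t) * (a * (t + B / \<sigma>) + 2 * D)))
      + 4 * (\<mu> * sqrt (variance G) / \<sigma>\<^sup>2)"
proof -
  define A where "A = B / \<sigma>"
  have A: "0 < A" unfolding A_def using B_pos sigma_pos by simp
  define r where "r = t + A"
  have r: "0 < r" using t A by (simp add: r_def)
  let ?u = "upper_env r h" and ?l = "lower_env r h"
  note hm = test_classD(1)[OF H h] and hb = test_classD(2)[OF H h]
  have u: "?u \<in> H" and l: "?l \<in> H" using test_classD(3,4)[OF H h r] by auto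
  note um = test_classD(1)[OF H u] and ub = test_classD(2)[OF H u]
  note lm = test_classD(1)[OF H l] and lb = test_classD(2)[OF H l]
  define q where "q = (\<lambda>x. A / (2 * t) * (?u x - ?l x))"
  have q_meas: "q \<in> borel_measurable borel" unfolding q_def using um lm by measurable
  have q_bnd: "\<bar>q x\<bar> \<le> A / (2 * t) * 2" for x
    unfolding q_def abs_mult using A t ub[of x] lb[of x] by (intro mult_mono) auto
  have osc: "\<bar>moving_average t h y - moving_average t h x\<bar> \<le> q x" if "\<bar>y - x\<bar> \<le> B / \<sigma>" for x y
  proof -
    have le: "?l x \<le> ?u x"
      using lower_env_lower[of h 1 x x r, OF hb] upper_env_upper[of h 1 x x r, OF hb] r by simp
    have "\<bar>moving_average t h y - moving_average t h x\<bar> \<le> \<bar>y - x\<bar> * (?u x - ?l x) / (2 * t)"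
      using that unfolding A_def[symmetric]
      by (intro moving_average_diff_le_abs[OF hm hb t, of _ _ A])
        (auto simp: r_def intro!: lower_env_lower[OF hb] upper_env_upper[OF hb])
    also have "\<dots> \<le> A * (?u x - ?l x) / (2 * t)"
      using that t le unfolding A_def[symmetric] by (intro divide_right_mono mult_right_mono) auto
    finally show ?thesis by (simp add: q_def)
  qed
  have "expectation (\<lambda>\<omega>. q (W \<omega>))
      = A / (2 * t) * (expectation (\<lambda>\<omega>. ?u (W \<omega>)) - expectation (\<lambda>\<omega>. ?l (W \<omega>)))"
    unfolding q_def using integrable_test[OF um ub] integrable_test[OF lm lb] by simp
  also have "\<dots> \<le> A / (2 * t) * (a * r + 2 * D)"
  proof (rule mult_left_mono)
    show "expectation (\<lambda>\<omega>. ?u (W \<omega>)) - expectation (\<lambda>\<omega>. ?l (W \<omega>)) \<le> a * r + 2 * D"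
      using test_class_oscillation[OF H h r] D[OF u] D[OF l] unfolding error_def by linarith
  qed (use A t in auto)
  finally have q_mean: "expectation (\<lambda>\<omega>. q (W \<omega>)) \<le> A / (2 * t) * (a * r + 2 * D)" .
  have "\<bar>error (moving_average t h)\<bar>
      \<le> \<mu> / \<sigma> * (A * (9 * A + expectation (\<lambda>\<omega>. q (W \<omega>)))) + 4 * (\<mu> * sqrt (variance G) / \<sigma>\<^sup>2)"
    unfolding error_def A_def
    by (rule normal_approximation_of_continuous[OF continuous_moving_average[OF hm hb t]
          abs_moving_average_le[OF hm hb t] q_meas q_bnd osc])
  also have "\<dots> \<le> \<mu> / \<sigma> * (A * (9 * A + A / (2 * t) * (a * r + 2 * D)))
      + 4 * (\<mu> * sqrt (variance G) / \<sigma>\<^sup>2)"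
    using q_mean mu_pos sigma_pos A by (intro add_mono mult_left_mono order_refl) auto
  finally show ?thesis by (simp only: A_def r_def)
qed

text \<open>On radius \<open>t\<close> the moving average of the upper envelope dominates \<open>h\<close> and is dominated by
  the upper envelope of radius \<open>2 t\<close>; similarly from below.  So replacing \<open>h\<close> by one of these
  averages costs at most the normal mean of the oscillation on radius \<open>2 t\<close>.\<close>

lemma error_le_smoothed:
  assumes H: "test_class H a" and h: "h \<in> H" and t: "0 < t"
    and R: "\<And>k. k \<in> H \<Longrightarrow> \<bar>error (moving_average t k)\<bar> \<le> R"
  shows "\<bar>error h\<bar> \<le> R + 2 * a * t"
proof -
  note hm = test_classD(1)[OF H h] and hb = test_classD(2)[OF H h]
  let ?u = "upper_env t h" and ?l = "lower_env t h"
  let ?U = "upper_env (2 * t) h" and ?L = "lower_env (2 * t) h"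
  have t2: "0 < 2 * t" using t by simp
  have u: "?u \<in> H" and l: "?l \<in> H" and U: "?U \<in> H" and L: "?L \<in> H"
    using test_classD(3,4)[OF H h t] test_classD(3,4)[OF H h t2] by auto
  note um = test_classD(1)[OF H u] and ub = test_classD(2)[OF H u]
  note lm = test_classD(1)[OF H l] and lb = test_classD(2)[OF H l]
  note Um = test_classD(1)[OF H U] and Ub = test_classD(2)[OF H U]
  note Lm = test_classD(1)[OF H L] and Lb = test_classD(2)[OF H L]
  define g where "g = moving_average t ?u"
  define k where "k = moving_average t ?l"
  have gm: "g \<in> borel_measurable borel" and gb: "\<bar>g x\<bar> \<le> 1" for x
    unfolding g_def using continuous_moving_average[OF um ub t] abs_moving_average_le[OF um ub t]
    by (auto intro: borel_measurable_continuous_onI)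
  have km: "k \<in> borel_measurable borel" and kb: "\<bar>k x\<bar> \<le> 1" for x
    unfolding k_def using continuous_moving_average[OF lm lb t] abs_moving_average_le[OF lm lb t]
    by (auto intro: borel_measurable_continuous_onI)
  have g_bounds: "h x \<le> g x \<and> g x \<le> ?U x" for x
    unfolding g_def using t
    by (intro moving_average_bounds[OF um ub t])
      (auto intro!: upper_env_upper[OF hb] upper_env_nested[OF hb] simp: abs_minus_commute)
  have k_bounds: "?L x \<le> k x \<and> k x \<le> h x" for x
    unfolding k_def using t
    by (intro moving_average_bounds[OF lm lb t])
      (auto intro!: lower_env_lower[OF hb] lower_env_nested[OF hb] simp: abs_minus_commute)
  have osc: "normal_mean ?U - normal_mean ?L \<le> 2 * a * t"
    using test_class_oscillation[OF H h t2] by (simp add: algebra_simps)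
  have "expectation (\<lambda>\<omega>. h (W \<omega>)) \<le> expectation (\<lambda>\<omega>. g (W \<omega>))"
    "expectation (\<lambda>\<omega>. k (W \<omega>)) \<le> expectation (\<lambda>\<omega>. h (W \<omega>))"
    using g_bounds k_bounds
    by (auto intro!: integral_mono integrable_test[OF hm hb] integrable_test[OF gm gb]
        integrable_test[OF km kb])
  moreover have "normal_mean g \<le> normal_mean ?U" "normal_mean ?L \<le> normal_mean k"
    "normal_mean k \<le> normal_mean h" "normal_mean h \<le> normal_mean g"
    using g_bounds k_bounds
    by (auto intro!: normal_mean_mono[OF gm gb Um Ub] normal_mean_mono[OF Lm Lb km kb]
        normal_mean_mono[OF km kb hm hb] normal_mean_mono[OF hm hb gm gb])
  moreover have "\<bar>error g\<bar> \<le> R" "\<bar>error k\<bar> \<le> R"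
    unfolding g_def k_def using R u l by auto
  ultimately show ?thesis using osc unfolding error_def by linarith
qed

text \<open>With \<open>t = 2 (\<mu> / \<sigma>) A\<^sup>2\<close> the factor in front of the error that comes back is exactly
  \<open>1 / 2\<close>, so the supremum of the error over the class can be absorbed.\<close>

lemma error_le_of_test_class:
  assumes H: "test_class H a" and h: "h \<in> H"
  defines "A \<equiv> B / \<sigma>"
  shows "\<bar>error h\<bar> \<le> a * A / 2 + \<mu> / \<sigma> * ((18 + 9 * a) * A\<^sup>2)
    + 8 * (\<mu> * sqrt (variance G) / \<sigma>\<^sup>2)"
proof -
  define \<kappa> where "\<kappa> = \<mu> / \<sigma>"
  define \<Delta> where "\<Delta> = \<mu> * sqrt (variance G) / \<sigma>\<^sup>2"
  define t where "t = 2 * \<kappa> * A\<^sup>2"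
  define D where "D = (SUP k\<in>H. \<bar>error k\<bar>)"
  have "0 < \<kappa>" "0 < A" unfolding \<kappa>_def A_def using mu_pos sigma_pos B_pos by auto
  then have t: "0 < t" by (simp add: t_def)
  have bdd: "bdd_above ((\<lambda>k. \<bar>error k\<bar>) ` H)"
    using abs_error_le_2 test_classD(1,2)[OF H] by (intro bdd_aboveI[of _ 2]) auto
  have D: "\<bar>error k\<bar> \<le> D" if "k \<in> H" for k
    unfolding D_def using bdd that by (intro cSUP_upper)
  define R where "R = \<kappa> * (A * (9 * A + A / (2 * t) * (a * (t + A) + 2 * D))) + 4 * \<Delta>"
  have "\<bar>error k\<bar> \<le> R + 2 * a * t" if "k \<in> H" for k
    using error_le_smoothed[OF H that t, of R] error_moving_average_le[OF H _ t D]
    unfolding R_def \<kappa>_def A_def \<Delta>_def by blast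
  then have "D \<le> R + 2 * a * t"
    unfolding D_def using h by (intro cSUP_least) auto
  moreover have "R = 9 * (\<kappa> * A\<^sup>2) + (a * (t + A) + 2 * D) / 4 + 4 * \<Delta>"
    using \<open>0 < \<kappa>\<close> \<open>0 < A\<close> unfolding R_def t_def by (simp add: field_simps power2_eq_square)
  ultimately have "D \<le> 18 * (\<kappa> * A\<^sup>2) + a * A / 2 + 9 / 2 * (a * t) + 8 * \<Delta>"
    by (simp add: field_simps)
  then show ?thesis
    using D[OF h] unfolding t_def \<kappa>_def[symmetric] \<Delta>_def[symmetric] by (simp add: algebra_simps)
qed

end

section \<open>Indicators of half lines and of intervals\<close>

definition dilation :: "real \<Rightarrow> real set \<Rightarrow> real set" where
  "dilation \<epsilon> S = {x. \<exists>y\<in>S. \<bar>y - x\<bar> \<le> \<epsilon>}"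

definition erosion :: "real \<Rightarrow> real set \<Rightarrow> real set" where
  "erosion \<epsilon> S = {x. \<forall>y. \<bar>y - x\<bar> \<le> \<epsilon> \<longrightarrow> y \<in> S}"

lemma upper_env_indicator:
  assumes "0 \<le> \<epsilon>"
  shows "upper_env \<epsilon> (indicator S) = indicator (dilation \<epsilon> S)"
proof
  fix x
  have bnd: "\<bar>indicator S y :: real\<bar> \<le> 1" for y by (simp add: indicator_def)
  show "upper_env \<epsilon> (indicator S) x = indicator (dilation \<epsilon> S) x"
  proof (rule antisym)
    show "upper_env \<epsilon> (indicator S) x \<le> indicator (dilation \<epsilon> S) x"
      using assms by (rule upper_env_least) (auto simp: indicator_def dilation_def)
    show "indicator (dilation \<epsilon> S) x \<le> upper_env \<epsilon> (indicator S) x"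
    proof (cases "x \<in> dilation \<epsilon> S")
      case True
      then obtain y where "y \<in> S" "\<bar>y - x\<bar> \<le> \<epsilon>" by (auto simp: dilation_def)
      then show ?thesis using upper_env_upper[of "indicator S" 1 y x \<epsilon>, OF bnd] True by simp
    next
      case False
      then show ?thesis
        using upper_env_upper[of "indicator S" 1 x x \<epsilon>, OF bnd] assms
        by (auto intro: order_trans[OF indicator_pos_le])
    qed
  qed
qed

lemma lower_env_indicator:
  assumes "0 \<le> \<epsilon>"
  shows "lower_env \<epsilon> (indicator S) = indicator (erosion \<epsilon> S)"
proof
  fix x
  have bnd: "\<bar>indicator S y :: real\<bar> \<le> 1" for y by (simp add: indicator_def)
  show "lower_env \<epsilon> (indicator S) x = indicator (erosion \<epsilon> S) x"
  proof (rule antisym)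
    show "indicator (erosion \<epsilon> S) x \<le> lower_env \<epsilon> (indicator S) x"
      using assms by (rule lower_env_greatest) (auto simp: indicator_def erosion_def)
    show "lower_env \<epsilon> (indicator S) x \<le> indicator (erosion \<epsilon> S) x"
    proof (cases "x \<in> erosion \<epsilon> S")
      case True
      then show ?thesis
        using lower_env_lower[of "indicator S" 1 x x \<epsilon>, OF bnd] assms
        by (auto intro: order_trans[OF _ indicator_le_1])
    next
      case False
      then obtain y where "y \<notin> S" "\<bar>y - x\<bar> \<le> \<epsilon>" by (auto simp: erosion_def)
      then show ?thesis using lower_env_lower[of "indicator S" 1 y x \<epsilon>, OF bnd] False by simp
    qed
  qed
qed

lemma is_interval_dilation:
  assumes "is_interval S"
  shows "is_interval (dilation \<epsilon> S)"
  unfolding is_interval_1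
proof (intro ballI allI impI)
  fix a b x assume "a \<in> dilation \<epsilon> S" "b \<in> dilation \<epsilon> S" and x: "a \<le> x \<and> x \<le> b"
  then obtain y z where y: "y \<in> S" "\<bar>y - a\<bar> \<le> \<epsilon>" and z: "z \<in> S" "\<bar>z - b\<bar> \<le> \<epsilon>"
    by (auto simp: dilation_def)
  \<comment> \<open>The point of the segment between \<open>y\<close> and \<open>z\<close> that is nearest to \<open>x\<close>.\<close>
  let ?w = "max (min y z) (min x (max y z))"
  have "min y z \<in> S" "max y z \<in> S" using y z by (auto simp: min_def max_def)
  then have "?w \<in> S" using assms unfolding is_interval_1 by (smt (verit))
  moreover have "\<bar>?w - x\<bar> \<le> \<epsilon>" using y(2) z(2) x by (auto simp: min_def max_def)
  ultimately show "x \<in> dilation \<epsilon> S" by (auto simp: dilation_def)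
qed

lemma is_interval_erosion:
  assumes "is_interval S"
  shows "is_interval (erosion \<epsilon> S)"
  unfolding is_interval_1
proof (intro ballI allI impI)
  fix a b x assume a: "a \<in> erosion \<epsilon> S" and b: "b \<in> erosion \<epsilon> S" and x: "a \<le> x \<and> x \<le> b"
  show "x \<in> erosion \<epsilon> S"
    unfolding erosion_def
  proof (intro CollectI allI impI)
    fix y assume y: "\<bar>y - x\<bar> \<le> \<epsilon>"
    have "a + (y - x) \<in> S" "b + (y - x) \<in> S" using a b y by (auto simp: erosion_def)
    moreover have "a + (y - x) \<le> y" "y \<le> b + (y - x)" using x by auto
    ultimately show "y \<in> S" using assms unfolding is_interval_1 by blast
  qed
qed

lemma is_interval_affine_preimage:
  fixes S :: "real set"
  assumes "is_interval S"
  shows "is_interval {x. c * x + d \<in> S}"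
  unfolding is_interval_1
proof (intro ballI allI impI)
  fix a b x assume ab: "a \<in> {x. c * x + d \<in> S}" "b \<in> {x. c * x + d \<in> S}" and x: "a \<le> x \<and> x \<le> b"
  have "(c * a \<le> c * x \<and> c * x \<le> c * b) \<or> (c * b \<le> c * x \<and> c * x \<le> c * a)"
    using x by (cases "0 \<le> c") (auto intro: mult_left_mono mult_left_mono_neg)
  then have "(c * a + d \<le> c * x + d \<and> c * x + d \<le> c * b + d)
      \<or> (c * b + d \<le> c * x + d \<and> c * x + d \<le> c * a + d)" by simp
  then show "x \<in> {x. c * x + d \<in> S}"
    using ab assms unfolding is_interval_1 mem_Collect_eq by blast
qed

lemma compl_dilation: "- dilation \<epsilon> S = erosion \<epsilon> (- S)"
  by (auto simp: dilation_def erosion_def)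

lemma compl_erosion: "- erosion \<epsilon> S = dilation \<epsilon> (- S)"
  by (auto simp: dilation_def erosion_def)

lemma subset_Icc_of_diameter:
  fixes Q :: "real set"
  assumes "\<And>x y. x \<in> Q \<Longrightarrow> y \<in> Q \<Longrightarrow> y - x \<le> d"
  shows "\<exists>l. Q \<subseteq> {l..l + d}"
proof (cases "Q = {}")
  case False
  then obtain q where q: "q \<in> Q" by blast
  have bdd: "bdd_below Q"
    using assms[OF _ q] by (intro bdd_belowI[of _ "q - d"]) (auto simp: diff_le_eq add.commute)
  have "x \<in> {Inf Q..Inf Q + d}" if x: "x \<in> Q" for x
  proof -
    have "x - d \<le> Inf Q"
      using False assms[OF _ x] by (intro cInf_greatest) (auto simp: diff_le_eq add.commute)
    then show ?thesis using cInf_lower[OF x bdd] by simp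
  qed
  then show ?thesis by blast
qed simp

lemma normal_mean_indicator_Icc_le:
  assumes "0 \<le> d"
  shows "normal_mean (indicator {l..l + d}) \<le> sqrt (2 / pi) * (d / 2)"
proof -
  have c: "sqrt (2 / pi) = 2 / sqrt (2 * pi)"
    by (rule real_sqrt_unique) (simp_all add: power_divide)
  interpret prob_space std_normal_distribution
    by (rule prob_space_normal_density) simp
  have "emeasure std_normal_distribution {l..l + d}
      = (\<integral>\<^sup>+x. ennreal (std_normal_density x) * indicator {l..l + d} x \<partial>lborel)"
    by (subst emeasure_density) auto
  also have "\<dots> \<le> (\<integral>\<^sup>+x. ennreal (1 / sqrt (2 * pi)) * indicator {l..l + d} x \<partial>lborel)"
    by (intro nn_integral_mono mult_right_mono ennreal_leI)
      (auto simp: std_normal_density_def divide_right_mono)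
  also have "\<dots> = ennreal (1 / sqrt (2 * pi) * d)"
    using assms by (subst nn_integral_cmult) (auto simp: ennreal_mult'[symmetric])
  finally have "measure std_normal_distribution {l..l + d} \<le> 1 / sqrt (2 * pi) * d"
    using assms by (simp add: emeasure_eq_measure)
  also have "\<dots> = sqrt (2 / pi) * (d / 2)" by (simp add: c)
  finally show ?thesis by (simp add: normal_mean_def)
qed

lemma normal_mean_indicator_Un_le:
  assumes "A \<in> sets borel" "B \<in> sets borel"
  shows "normal_mean (indicator (A \<union> B)) \<le> normal_mean (indicator A) + normal_mean (indicator B)"
proof -
  interpret prob_space std_normal_distribution
    by (rule prob_space_normal_density) simp
  show ?thesis using measure_Un_le[of A std_normal_distribution B] assms by (simp add: normal_mean_def)
qed

text \<open>A class of sets gives a test class as soon as it is closed under affine preimages,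
  dilations and erosions; the oscillation of an indicator is the indicator of the part of the
  dilation outside the erosion.\<close>

lemma test_class_indicators:
  assumes meas: "\<And>S. S \<in> \<S> \<Longrightarrow> S \<in> sets borel"
    and affine: "\<And>S c d. S \<in> \<S> \<Longrightarrow> {x. c * x + d \<in> S} \<in> \<S>"
    and dil: "\<And>S \<epsilon>. S \<in> \<S> \<Longrightarrow> 0 < \<epsilon> \<Longrightarrow> dilation \<epsilon> S \<in> \<S>"
    and ero: "\<And>S \<epsilon>. S \<in> \<S> \<Longrightarrow> 0 < \<epsilon> \<Longrightarrow> erosion \<epsilon> S \<in> \<S>"
    and boundary: "\<And>S \<epsilon>. S \<in> \<S> \<Longrightarrow> 0 < \<epsilon> \<Longrightarrow>
      \<exists>Q\<in>sets borel. dilation \<epsilon> S - erosion \<epsilon> S \<subseteq> Q \<and> normal_mean (indicator Q) \<le> a * \<epsilon>"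
  shows "test_class {indicator S | S. S \<in> \<S>} a"
  unfolding test_class_def
proof (intro conjI ballI allI impI)
  show "{indicator S | S. S \<in> \<S>} \<subseteq> borel_measurable borel"
    using meas by auto
next
  fix h :: "real \<Rightarrow> real" assume "h \<in> {indicator S | S. S \<in> \<S>}"
  then obtain S where S: "S \<in> \<S>" and h: "h = indicator S" by blast
  show "\<bar>h x\<bar> \<le> 1" for x by (simp add: h indicator_def)
  have "(\<lambda>x. h (c * x + d)) = indicator {x. c * x + d \<in> S}" for c d
    by (auto simp: h indicator_def)
  then show "(\<lambda>x. h (c * x + d)) \<in> {indicator S | S. S \<in> \<S>}" for c d
    using affine[OF S] by blast
  fix \<epsilon> :: real assume \<epsilon>: "0 < \<epsilon>"
  have u: "upper_env \<epsilon> h = indicator (dilation \<epsilon> S)" and l: "lower_env \<epsilon> h = indicator (erosion \<epsilon> S)"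
    using \<epsilon> by (simp_all add: h upper_env_indicator lower_env_indicator)
  show "upper_env \<epsilon> h \<in> {indicator S | S. S \<in> \<S>}" "lower_env \<epsilon> h \<in> {indicator S | S. S \<in> \<S>}"
    unfolding u l using dil[OF S \<epsilon>] ero[OF S \<epsilon>] by blast+
  obtain Q where Q: "Q \<in> sets borel" "dilation \<epsilon> S - erosion \<epsilon> S \<subseteq> Q"
      "normal_mean (indicator Q) \<le> a * \<epsilon>"
    using boundary[OF S \<epsilon>] by blast
  have "normal_mean (\<lambda>x. upper_env \<epsilon> h x - lower_env \<epsilon> h x) \<le> normal_mean (indicator Q)"
    unfolding u l
  proof (rule normal_mean_mono[where C=1 and D=1])
    show "(\<lambda>x. indicator (dilation \<epsilon> S) x - indicator (erosion \<epsilon> S) x :: real) \<in> borel_measurable borel"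
      using meas[OF dil[OF S \<epsilon>]] meas[OF ero[OF S \<epsilon>]] by simp
  qed (use Q in \<open>auto simp: indicator_def\<close>)
  with Q(3) show "normal_mean (\<lambda>x. upper_env \<epsilon> h x - lower_env \<epsilon> h x) \<le> a * \<epsilon>" by linarith
qed

text \<open>The points near an interval and near its complement lie near a left end, in the sense that
  a point outside precedes a point inside, or near a right end.  Two points near a left end are at
  most \<open>2 \<epsilon>\<close> apart, as otherwise an outside point would separate two inside points.\<close>

lemma interval_boundary_left:
  fixes S :: "real set"
  assumes "is_interval S"
  shows "\<exists>l. {x. \<exists>y\<in>S. \<exists>z. z \<notin> S \<and> \<bar>y - x\<bar> \<le> \<epsilon> \<and> \<bar>z - x\<bar> \<le> \<epsilon> \<and> z < y} \<subseteq> {l..l + 2 * \<epsilon>}"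
proof (intro subset_Icc_of_diameter leI notI)
  fix x x'
  assume "x \<in> {x. \<exists>y\<in>S. \<exists>z. z \<notin> S \<and> \<bar>y - x\<bar> \<le> \<epsilon> \<and> \<bar>z - x\<bar> \<le> \<epsilon> \<and> z < y}"
    and "x' \<in> {x. \<exists>y\<in>S. \<exists>z. z \<notin> S \<and> \<bar>y - x\<bar> \<le> \<epsilon> \<and> \<bar>z - x\<bar> \<le> \<epsilon> \<and> z < y}"
    and far: "2 * \<epsilon> < x' - x"
  then obtain y y' z' where "y \<in> S" "\<bar>y - x\<bar> \<le> \<epsilon>"
    and "y' \<in> S" "z' \<notin> S" "\<bar>z' - x'\<bar> \<le> \<epsilon>" "z' < y'" by blast
  moreover from this far have "y \<le> z'" "z' \<le> y'" by linarith+
  ultimately show False using assms unfolding is_interval_1 by blast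
qed

lemma interval_boundary_right:
  fixes S :: "real set"
  assumes "is_interval S"
  shows "\<exists>l. {x. \<exists>y\<in>S. \<exists>z. z \<notin> S \<and> \<bar>y - x\<bar> \<le> \<epsilon> \<and> \<bar>z - x\<bar> \<le> \<epsilon> \<and> y < z} \<subseteq> {l..l + 2 * \<epsilon>}"
proof (intro subset_Icc_of_diameter leI notI)
  fix x x'
  assume "x \<in> {x. \<exists>y\<in>S. \<exists>z. z \<notin> S \<and> \<bar>y - x\<bar> \<le> \<epsilon> \<and> \<bar>z - x\<bar> \<le> \<epsilon> \<and> y < z}"
    and "x' \<in> {x. \<exists>y\<in>S. \<exists>z. z \<notin> S \<and> \<bar>y - x\<bar> \<le> \<epsilon> \<and> \<bar>z - x\<bar> \<le> \<epsilon> \<and> y < z}"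
    and far: "2 * \<epsilon> < x' - x"
  then obtain y z y' where "y \<in> S" "z \<notin> S" "\<bar>z - x\<bar> \<le> \<epsilon>" "y < z"
    and "y' \<in> S" "\<bar>y' - x'\<bar> \<le> \<epsilon>" by blast
  moreover from this far have "y \<le> z" "z \<le> y'" by linarith+
  ultimately show False using assms unfolding is_interval_1 by blast
qed

text \<open>If \<open>S\<close> and its complement are both intervals, there is only one end: two boundary points more
  than \<open>2 \<epsilon>\<close> apart would give a point of one of the two sets between two points of the other.\<close>

lemma half_line_boundary:
  assumes "is_interval S" "is_interval (- S)"
  shows "\<exists>l. dilation \<epsilon> S - erosion \<epsilon> S \<subseteq> {l..l + 2 * \<epsilon>}"
proof (intro subset_Icc_of_diameter leI notI)
  fix x x' assume "x \<in> dilation \<epsilon> S - erosion \<epsilon> S" "x' \<in> dilation \<epsilon> S - erosion \<epsilon> S"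
    and far: "2 * \<epsilon> < x' - x"
  then obtain y z y' z' where S: "y \<in> S" "z \<in> - S" "y' \<in> S" "z' \<in> - S"
    and near: "\<bar>y - x\<bar> \<le> \<epsilon>" "\<bar>z - x\<bar> \<le> \<epsilon>" "\<bar>y' - x'\<bar> \<le> \<epsilon>" "\<bar>z' - x'\<bar> \<le> \<epsilon>"
    unfolding dilation_def erosion_def by blast
  consider "y \<le> z" "z \<le> y'" | "z \<le> y" "y \<le> z'" using near far by linarith
  then show False
  proof cases
    case 1
    then have "z \<in> S" using S assms(1) unfolding is_interval_1 by blast
    then show False using S by simp
  next
    case 2
    then have "y \<in> - S" using S assms(2) unfolding is_interval_1 by blast
    then show False using S by simp
  qed
qed

lemma interval_indicators_test_class: "test_class interval_indicators (2 * sqrt (2 / pi))"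
proof -
  have "test_class {indicator S | S. S \<in> {S. is_interval S}} (2 * sqrt (2 / pi))"
  proof (rule test_class_indicators)
    fix S :: "real set" and \<epsilon> :: real
    assume "S \<in> {S. is_interval S}" and \<epsilon>: "0 < \<epsilon>"
    then have S: "is_interval S" by simp
    obtain l r where
      l: "{x. \<exists>y\<in>S. \<exists>z. z \<notin> S \<and> \<bar>y - x\<bar> \<le> \<epsilon> \<and> \<bar>z - x\<bar> \<le> \<epsilon> \<and> z < y} \<subseteq> {l..l + 2 * \<epsilon>}" and
      r: "{x. \<exists>y\<in>S. \<exists>z. z \<notin> S \<and> \<bar>y - x\<bar> \<le> \<epsilon> \<and> \<bar>z - x\<bar> \<le> \<epsilon> \<and> y < z} \<subseteq> {r..r + 2 * \<epsilon>}"
      using interval_boundary_left[OF S] interval_boundary_right[OF S] by blast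
    have "dilation \<epsilon> S - erosion \<epsilon> S \<subseteq> {l..l + 2 * \<epsilon>} \<union> {r..r + 2 * \<epsilon>}"
    proof
      fix x assume "x \<in> dilation \<epsilon> S - erosion \<epsilon> S"
      then obtain y z where "y \<in> S" "z \<notin> S" "\<bar>y - x\<bar> \<le> \<epsilon>" "\<bar>z - x\<bar> \<le> \<epsilon>"
        unfolding dilation_def erosion_def by blast
      moreover from this have "z < y \<or> y < z" by (metis linorder_neqE)
      ultimately show "x \<in> {l..l + 2 * \<epsilon>} \<union> {r..r + 2 * \<epsilon>}" using l r by blast
    qed
    moreover have "normal_mean (indicator ({l..l + 2 * \<epsilon>} \<union> {r..r + 2 * \<epsilon>}))
        \<le> 2 * sqrt (2 / pi) * \<epsilon>"
      using normal_mean_indicator_Un_le[of "{l..l + 2 * \<epsilon>}" "{r..r + 2 * \<epsilon>}"]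
        normal_mean_indicator_Icc_le[of "2 * \<epsilon>" l] normal_mean_indicator_Icc_le[of "2 * \<epsilon>" r] \<epsilon>
      by simp
    ultimately show "\<exists>Q\<in>sets borel. dilation \<epsilon> S - erosion \<epsilon> S \<subseteq> Q
        \<and> normal_mean (indicator Q) \<le> 2 * sqrt (2 / pi) * \<epsilon>"
      by (intro bexI[of _ "{l..l + 2 * \<epsilon>} \<union> {r..r + 2 * \<epsilon>}"]) auto
  qed (auto intro: real_interval_borel_measurable is_interval_affine_preimage
      is_interval_dilation is_interval_erosion)
  then show ?thesis by (simp add: interval_indicators_def)
qed

text \<open>Half lines are not closed under the constant maps \<open>x \<mapsto> 0 x + d\<close>; adding the empty set and
  the whole line gives exactly the intervals whose complement is an interval.\<close>

lemma half_line_indicators_subset_test_class: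
  defines "H \<equiv> {indicator S | S. S \<in> {S. is_interval S \<and> is_interval (- S)}}"
  shows "half_line_indicators \<subseteq> H" and "test_class H (sqrt (2 / pi))"
proof -
  have "is_interval S \<and> is_interval (- S)" if "S \<in> half_lines" for S
    using that unfolding half_lines_def
    by (auto simp: is_interval_ci is_interval_ic is_interval_oi is_interval_io)
  then show "half_line_indicators \<subseteq> H"
    unfolding half_line_indicators_def H_def by blast
  show "test_class H (sqrt (2 / pi))"
    unfolding H_def
  proof (rule test_class_indicators)
    fix S :: "real set" and \<epsilon> :: real
    assume S: "S \<in> {S. is_interval S \<and> is_interval (- S)}" and \<epsilon>: "0 < \<epsilon>"
    then obtain l where l: "dilation \<epsilon> S - erosion \<epsilon> S \<subseteq> {l..l + 2 * \<epsilon>}"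
      using half_line_boundary by blast
    then show "\<exists>Q\<in>sets borel. dilation \<epsilon> S - erosion \<epsilon> S \<subseteq> Q
        \<and> normal_mean (indicator Q) \<le> sqrt (2 / pi) * \<epsilon>"
      using normal_mean_indicator_Icc_le[of "2 * \<epsilon>" l] \<epsilon>
      by (intro bexI[of _ "{l..l + 2 * \<epsilon>}"]) auto
    show "dilation \<epsilon> S \<in> {S. is_interval S \<and> is_interval (- S)}"
      "erosion \<epsilon> S \<in> {S. is_interval S \<and> is_interval (- S)}"
      using S by (auto simp: compl_dilation compl_erosion
          intro: is_interval_dilation is_interval_erosion)
  next
    fix S :: "real set" and c d :: real
    assume S: "S \<in> {S. is_interval S \<and> is_interval (- S)}"
    have "- {x. c * x + d \<in> S} = {x. c * x + d \<in> - S}" by auto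
    then show "{x. c * x + d \<in> S} \<in> {S. is_interval S \<and> is_interval (- S)}"
      using S by (auto simp del: Compl_iff intro: is_interval_affine_preimage)
  qed (auto intro: real_interval_borel_measurable)
qed

section \<open>The explicit bounds\<close>

theorem theorem1p2:
  fixes M :: "'a measure" and Y Ys W :: "'a \<Rightarrow> real" and \<mu> \<sigma> B A \<Delta> :: real
  assumes "prob_space M"
    and "Y \<in> borel_measurable M"
    and "AE \<omega> in M. Y \<omega> \<ge> 0"
    and "integrable M (\<lambda>\<omega>. (Y \<omega>)\<^sup>2)"
    and "prob_space.expectation M Y = \<mu>"
    and "prob_space.variance M Y = \<sigma>\<^sup>2"
    and "\<sigma> > 0"
    and "has_size_biased_distribution M Ys M Y"
    and "AE \<omega> in M. \<bar>Ys \<omega> - Y \<omega>\<bar> \<le> B"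
    and "B \<le> \<sigma> powr (3/2) / sqrt (6 * \<mu>)"
    and "W = (\<lambda>\<omega>. (Y \<omega> - \<mu>) / \<sigma>)"
    and "A = B / \<sigma>"
    and "\<Delta> = sqrt (prob_space.variance M (cond_exp_given M (\<lambda>\<omega>. Ys \<omega> - Y \<omega>) Y))"
  shows "(\<forall>H a. test_class H a \<longrightarrow>
            normal_distance M W H
              \<le> ereal (a * A / 2 + \<mu> / \<sigma> * ((19 + 56 * a) * A\<^sup>2 + 4 * A ^ 3) + 23 * \<mu> * \<Delta> / \<sigma>\<^sup>2))
       \<and> normal_distance M W half_line_indicators
           \<le> ereal (0.4 * A + \<mu> / \<sigma> * (64 * A\<^sup>2 + 4 * A ^ 3) + 23 * \<Delta> * \<mu> / \<sigma>\<^sup>2)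
       \<and> normal_distance M W interval_indicators
           \<le> ereal (0.8 * A + \<mu> / \<sigma> * (109 * A\<^sup>2 + 4 * A ^ 3) + 23 * \<Delta> * \<mu> / \<sigma>\<^sup>2)"
proof -
  interpret C: bounded_size_bias_coupling M Y Ys \<mu> \<sigma> B
    using assms(1-9) by (simp add: bounded_size_bias_coupling_def bounded_size_bias_coupling_axioms_def)
  have W: "W = C.W" unfolding assms(11) by (rule ext) (simp add: C.W_def)
  have \<Delta>: "\<Delta> = sqrt (C.variance C.G)" unfolding assms(13) by (simp add: C.G_def)
  define \<kappa> where "\<kappa> = \<mu> / \<sigma>"
  define v where "v = \<mu> * \<Delta> / \<sigma>\<^sup>2"
  have \<kappa>: "0 \<le> \<kappa>" unfolding \<kappa>_def using C.mu_pos C.sigma_pos by simp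
  have A: "0 \<le> A" unfolding assms(12) using C.B_pos C.sigma_pos by simp
  have "0 \<le> \<Delta>" unfolding \<Delta> using C.variance_positive[of C.G] by simp
  then have v: "0 \<le> v" unfolding v_def using C.mu_pos by simp
  have v_eq: "23 * \<mu> * \<Delta> / \<sigma>\<^sup>2 = 23 * v" "23 * \<Delta> * \<mu> / \<sigma>\<^sup>2 = 23 * v" by (simp_all add: v_def)
  \<comment> \<open>One bound with free coefficients covers the three claims.\<close>
  have general: "normal_distance M W H \<le> ereal (b * A + \<kappa> * (c * A\<^sup>2 + 4 * A ^ 3) + 23 * v)"
    if H: "test_class H a" and b: "a \<le> 2 * b" and c: "18 + 9 * a \<le> c" for H a b c
    unfolding normal_distance_def
  proof (rule SUP_least)
    fix h assume h: "h \<in> H"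
    have "a / 2 * A \<le> b * A" using b A by (intro mult_right_mono) auto
    moreover have "\<kappa> * ((18 + 9 * a) * A\<^sup>2) \<le> \<kappa> * (c * A\<^sup>2 + 4 * A ^ 3)"
      using \<kappa> A c by (intro mult_left_mono add_increasing2 mult_right_mono) auto
    moreover have "\<bar>C.error h\<bar> \<le> a * A / 2 + \<kappa> * ((18 + 9 * a) * A\<^sup>2) + 8 * v"
      using C.error_le_of_test_class[OF H h] unfolding \<kappa>_def v_def \<Delta> assms(12) .
    ultimately have "\<bar>C.error h\<bar> \<le> b * A + \<kappa> * (c * A\<^sup>2 + 4 * A ^ 3) + 23 * v"
      using v by simp
    then show "ereal \<bar>(\<integral>\<omega>. h (W \<omega>) \<partial>M) - normal_mean h\<bar>
        \<le> ereal (b * A + \<kappa> * (c * A\<^sup>2 + 4 * A ^ 3) + 23 * v)"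
      by (simp add: C.error_def W)
  qed
  have "2 / pi \<le> (0.8 :: real)\<^sup>2"
    using pi_approx by (simp add: field_simps power2_eq_square)
  then have sqrt_le: "sqrt (2 / pi) \<le> 0.8" by (rule real_le_lsqrt[rotated]) simp
  show ?thesis
    unfolding v_eq \<kappa>_def[symmetric]
  proof (intro conjI allI impI)
    fix H a assume H: "test_class H a"
    show "normal_distance M W H
        \<le> ereal (a * A / 2 + \<kappa> * ((19 + 56 * a) * A\<^sup>2 + 4 * A ^ 3) + 23 * v)"
    proof (cases "H = {}")
      case True
      then show ?thesis by (simp add: normal_distance_def)
    next
      case False
      then have "0 \<le> a" using test_class_nonneg[OF H] by blast
      then show ?thesis using general[OF H, of "a / 2" "19 + 56 * a"] by simp
    qed
  next
    show "normal_distance M W half_line_indicators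
        \<le> ereal (0.4 * A + \<kappa> * (64 * A\<^sup>2 + 4 * A ^ 3) + 23 * v)"
      using sqrt_le
      by (intro normal_distance_le_of_superset[OF half_line_indicators_subset_test_class(1)]
          general[OF half_line_indicators_subset_test_class(2)]) auto
  next
    show "normal_distance M W interval_indicators
        \<le> ereal (0.8 * A + \<kappa> * (109 * A\<^sup>2 + 4 * A ^ 3) + 23 * v)"
      using sqrt_le by (intro general[OF interval_indicators_test_class]) auto
  qed
qed

end
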